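(* Let $\mathcal{A}$ be a reducible $3\times 3$ sign pattern. (1) $\mathcal{A}$ requires the nSMP if and only if $\mathcal{A}$ is equivalent to a fixed signing of one of the patterns $$\begin{bmatrix}\circledast&*&\circledast\\ *&0&\circledast\\ 0&0&0\end{bmatrix},\quad \begin{bmatrix}+&\oplus&\circledast\\ +&-&\circledast\\ 0&0&0\end{bmatrix},\quad \begin{bmatrix}+&+&\circledast\\ -&+&\circledast\\ 0&0&0\end{bmatrix},\quad \begin{bmatrix}\ominus&+&\circledast\\ -&\ominus&\circledast\\ 0&0&+\end{bmatrix},\quad \begin{bmatrix}-&\circledast&\circledast\\ 0&0&\circledast\\ 0&0&+\end{bmatrix},\quad \begin{bmatrix}0&\circledast&\circledast\\ 0&-&\circledast\\ 0&0&+\end{bmatrix}.$$ (2) $\mathcal{A}$ allows but does not require the nSMP if and only if $\mathcal{A}$ is equivalent to a fixed signing of one of the patterns $$\begin{bmatrix}+&+&\circledast\\ +&+&\circledast\\ 0&0&0\end{bmatrix},\quad \begin{bmatrix}+&+&\circledast\\ -&-&\circledast\\ 0&0&0\end{bmatrix},\quad \begin{bmatrix}+&+&\circledast\\ -&\circledast&\circledast\\ 0&0&+\end{bmatrix},\quad \begin{bmatrix}\circledast&+&\circledast\\ +&\circledast&\circledast\\ 0&0&+\end{bmatrix},\quad \begin{bmatrix}+&\circledast&\circledast\\ 0&\circledast&\circledast\\ 0&0&+\end{bmatrix},\quad \begin{bmatrix}\ominus&\circledast&\circledast\\ 0&+&\circledast\\ 0&0&+\end{bmatrix}.$$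
   Context: A real $n\times n$ matrix $A$ has the non-symmetric strong multiplicity property (nSMP) if the only real $n\times n$ matrix $X$ satisfying all of (1) $A\circ X=O$ (entrywise product), (2) $AX^T-X^TA=O$, and (3) $\mathrm{tr}(X^TA^k)=0$ for all $0\le k<n$, is $X=O$ (the zero matrix). A sign pattern is an $n\times n$ matrix $\mathcal{A}$ with entries in $\{+,-,0\}$; $Q(\mathcal{A})$ is the set of real $n\times n$ matrices $A$ with $A_{ij}>0$ if $\mathcal{A}_{ij}=+$, $A_{ij}<0$ if $\mathcal{A}_{ij}=-$, and $A_{ij}=0$ if $\mathcal{A}_{ij}=0$. The pattern $\mathcal{A}$ allows a property if some $A\in Q(\mathcal{A})$ has it, and requires a property if every $A\in Q(\mathcal{A})$ has it. A pattern is reducible if it is permutationally similar to a block upper triangular pattern with two square (nonempty) diagonal blocks. Two sign patterns are equivalent if one can be obtained from the other by permutation similarity, signature similarity (conjugation by a diagonal matrix with diagonal entries $\pm1$), transposition, and/or negation. In the displayed generalized patterns the symbols have the following meaning: $*$ is a nonzero real, $\oplus$ a nonnegative real, $\ominus$ a nonpositive real, $\circledast$ an arbitrary real. A fixed signing of such a pattern $\mathcal{B}$ is a sign pattern $\mathcal{A}$ with $Q(\mathcal{A})\subseteq Q(\mathcal{B})$, i.e. it is obtained by independently replacing each $*$ by an element of $\{+,-\}$, each $\oplus$ by an element of $\{0,+\}$, each $\ominus$ by an element of $\{0,-\}$, and each $\circledast$ by an element of $\{0,+,-\}$. *)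

theory Defs
  imports "Jordan_Normal_Form.Matrix" "HOL-Combinatorics.Permutations" Complex_Main
begin

definition hadamard_prod :: "'a::times mat \<Rightarrow> 'a mat \<Rightarrow> 'a mat" where
  "hadamard_prod A B = mat (dim_row A) (dim_col A) (\<lambda>(i, j). A $$ (i, j) * B $$ (i, j))"

definition mat_trace :: "'a::comm_monoid_add mat \<Rightarrow> 'a" where
  "mat_trace A = (\<Sum>i<dim_row A. A $$ (i, i))"

definition nSMP :: "nat \<Rightarrow> real mat \<Rightarrow> bool" where
  "nSMP n A \<longleftrightarrow> A \<in> carrier_mat n n \<and>
     (\<forall>X \<in> carrier_mat n n.
        hadamard_prod A X = 0\<^sub>m n n \<longrightarrow>
        A * transpose_mat X - transpose_mat X * A = 0\<^sub>m n n \<longrightarrow>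
        (\<forall>k<n. mat_trace (transpose_mat X * (A ^\<^sub>m k)) = 0) \<longrightarrow>
        X = 0\<^sub>m n n)"

datatype sign = Pos | Neg | Zero

fun sign_set :: "sign \<Rightarrow> real set" where
  "sign_set Pos = {x. x > 0}"
| "sign_set Neg = {x. x < 0}"
| "sign_set Zero = {0}"

text \<open>Entries of generalized patterns; the last four symbols are displayed in the literature
  as \<open>*\<close>, circled plus, circled minus and circled asterisk, in this order.\<close>

datatype gsign = GPos | GNeg | GZero | Nonzero | Nonneg | Nonpos | Any

fun gsign_set :: "gsign \<Rightarrow> real set" where
  "gsign_set GPos = {x. x > 0}"
| "gsign_set GNeg = {x. x < 0}"
| "gsign_set GZero = {0}"
| "gsign_set Nonzero = {x. x \<noteq> 0}"
| "gsign_set Nonneg = {x. x \<ge> 0}"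
| "gsign_set Nonpos = {x. x \<le> 0}"
| "gsign_set Any = UNIV"

definition pattern_class :: "('s \<Rightarrow> real set) \<Rightarrow> 's mat \<Rightarrow> real mat set" where
  "pattern_class S P = {M \<in> carrier_mat (dim_row P) (dim_col P).
     \<forall>i<dim_row P. \<forall>j<dim_col P. M $$ (i, j) \<in> S (P $$ (i, j))}"

definition Q_class :: "sign mat \<Rightarrow> real mat set" where
  "Q_class = pattern_class sign_set"

definition gQ_class :: "gsign mat \<Rightarrow> real mat set" where
  "gQ_class = pattern_class gsign_set"

definition allows :: "sign mat \<Rightarrow> (real mat \<Rightarrow> bool) \<Rightarrow> bool" where
  "allows A prop \<longleftrightarrow> (\<exists>M \<in> Q_class A. prop M)"

definition requires :: "sign mat \<Rightarrow> (real mat \<Rightarrow> bool) \<Rightarrow> bool" where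
  "requires A prop \<longleftrightarrow> (\<forall>M \<in> Q_class A. prop M)"

definition fixed_signing :: "sign mat \<Rightarrow> gsign mat \<Rightarrow> bool" where
  "fixed_signing A B \<longleftrightarrow> Q_class A \<subseteq> gQ_class B"

text \<open>Equivalently, every symbol of the generalized pattern is replaced independently by an
  admissible sign.\<close>

lemma fixed_signing_iff_entries:
  "fixed_signing A B \<longleftrightarrow> dim_row A = dim_row B \<and> dim_col A = dim_col B \<and>
     (\<forall>i<dim_row A. \<forall>j<dim_col A. sign_set (A $$ (i, j)) \<subseteq> gsign_set (B $$ (i, j)))"
proof
  assume sub: "fixed_signing A B"
  define r where "r s = (case s of Pos \<Rightarrow> 1 | Neg \<Rightarrow> -1 | Zero \<Rightarrow> (0::real))" for s
  have r: "r s \<in> sign_set s" for s by (cases s) (auto simp: r_def)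
  let ?M = "mat (dim_row A) (dim_col A) (\<lambda>ij. r (A $$ ij))"
  have "?M \<in> Q_class A" using r by (auto simp: Q_class_def pattern_class_def)
  then have "?M \<in> gQ_class B" using sub by (auto simp: fixed_signing_def)
  then have dims: "dim_row A = dim_row B" "dim_col A = dim_col B"
    by (auto simp: gQ_class_def pattern_class_def)
  have "x \<in> gsign_set (B $$ (i, j))"
    if ij: "i < dim_row A" "j < dim_col A" and x: "x \<in> sign_set (A $$ (i, j))" for i j x
  proof -
    let ?N = "mat (dim_row A) (dim_col A) (\<lambda>kl. if kl = (i, j) then x else r (A $$ kl))"
    have "?N \<in> Q_class A" using r x by (auto simp: Q_class_def pattern_class_def)
    then have "?N \<in> gQ_class B" using sub by (auto simp: fixed_signing_def)
    then have "?N $$ (i, j) \<in> gsign_set (B $$ (i, j))"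
      using ij dims by (simp only: gQ_class_def pattern_class_def mem_Collect_eq)
    then show ?thesis using ij by simp
  qed
  with dims show "dim_row A = dim_row B \<and> dim_col A = dim_col B \<and>
     (\<forall>i<dim_row A. \<forall>j<dim_col A. sign_set (A $$ (i, j)) \<subseteq> gsign_set (B $$ (i, j)))"
    by blast
next
  assume "dim_row A = dim_row B \<and> dim_col A = dim_col B \<and>
     (\<forall>i<dim_row A. \<forall>j<dim_col A. sign_set (A $$ (i, j)) \<subseteq> gsign_set (B $$ (i, j)))"
  then show "fixed_signing A B"
    unfolding fixed_signing_def Q_class_def gQ_class_def pattern_class_def subset_iff mem_Collect_eq
    by metis
qed

definition permute_mat :: "(nat \<Rightarrow> nat) \<Rightarrow> 'a mat \<Rightarrow> 'a mat" where
  "permute_mat p A = mat (dim_row A) (dim_col A) (\<lambda>(i, j). A $$ (p i, p j))"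

definition reducible_pattern :: "nat \<Rightarrow> sign mat \<Rightarrow> bool" where
  "reducible_pattern n A \<longleftrightarrow>
     (\<exists>p k. p permutes {..<n} \<and> 0 < k \<and> k < n \<and>
        (\<forall>i j. k \<le> i \<longrightarrow> i < n \<longrightarrow> j < k \<longrightarrow> permute_mat p A $$ (i, j) = Zero))"

fun sign_neg :: "sign \<Rightarrow> sign" where
  "sign_neg Pos = Neg"
| "sign_neg Neg = Pos"
| "sign_neg Zero = Zero"

fun sign_mult :: "sign \<Rightarrow> sign \<Rightarrow> sign" where
  "sign_mult Pos s = s"
| "sign_mult Neg s = sign_neg s"
| "sign_mult Zero s = Zero"

text \<open>Conjugation by the diagonal matrix whose diagonal entries are the signs \<open>d i\<close>.\<close>

definition signature_mat :: "(nat \<Rightarrow> sign) \<Rightarrow> sign mat \<Rightarrow> sign mat" where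
  "signature_mat d A =
     mat (dim_row A) (dim_col A) (\<lambda>(i, j). sign_mult (sign_mult (d i) (A $$ (i, j))) (d j))"

inductive pattern_step :: "nat \<Rightarrow> sign mat \<Rightarrow> sign mat \<Rightarrow> bool" for n where
  permutation: "p permutes {..<n} \<Longrightarrow> pattern_step n A (permute_mat p A)"
| signature: "(\<forall>i<n. d i \<in> {Pos, Neg}) \<Longrightarrow> pattern_step n A (signature_mat d A)"
| transposition: "pattern_step n A (transpose_mat A)"
| negation: "pattern_step n A (map_mat sign_neg A)"

text \<open>On \<open>n \<times> n\<close> patterns each step can be undone by a step of the same kind, so the reflexive
  transitive closure is already symmetric.\<close>

definition equivalent_patterns :: "nat \<Rightarrow> sign mat \<Rightarrow> sign mat \<Rightarrow> bool" where
  "equivalent_patterns n = (pattern_step n)\<^sup>*\<^sup>*"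

definition equivalent_to_signing_of :: "nat \<Rightarrow> sign mat \<Rightarrow> gsign mat \<Rightarrow> bool" where
  "equivalent_to_signing_of n A B \<longleftrightarrow>
     (\<exists>A' \<in> carrier_mat n n. fixed_signing A' B \<and> equivalent_patterns n A A')"

end

theory Submission
  imports Defs
begin

text \<open>
  Every reducible pattern is equivalent to one whose last row is \<open>(0, 0, *)\<close>. A real matrix with leading
  block \<open>B = [[a, b], [e, f]]\<close> and last row \<open>(0, 0, d)\<close> has the nSMP iff \<open>d\<close> is not an eigenvalue of \<open>B\<close>
  and not both \<open>b e = 0\<close> and \<open>a = f\<close>: a common eigenvalue of the diagonal blocks gives a nonzero
  \<open>X\<^sup>T\<close> supported in the off-diagonal block, while otherwise \<open>d\<close> can be split off and only the
  \<open>2 \<times> 2\<close> problem for \<open>B\<close> remains. This criterion ignores the other two entries of the last column, so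
  it only has to be read off for the signs of \<open>a, b, e, f, d\<close>; up to equivalence one
  may take \<open>b\<close> to be positive or zero and \<open>d\<close> to be positive or zero, and if \<open>B\<close> is triangular, only the
  order of the three diagonal signs up to reversal and negation matters.
\<close>

subsection \<open>Invariance of the nSMP under equivalence\<close>

text \<open>Bundling the conditions on \<open>X\<close> turns each symmetry of the nSMP into a rule
  that carries one witness to another.\<close>

definition nSMP_obstruction :: "nat \<Rightarrow> real mat \<Rightarrow> real mat \<Rightarrow> bool" where
  "nSMP_obstruction n A X \<longleftrightarrow> A \<in> carrier_mat n n \<and> X \<in> carrier_mat n n \<and>
     hadamard_prod A X = 0\<^sub>m n n \<and>
     A * transpose_mat X - transpose_mat X * A = 0\<^sub>m n n \<and>
     (\<forall>k<n. mat_trace (transpose_mat X * (A ^\<^sub>m k)) = 0)"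

lemma nSMP_iff_no_obstruction:
  "nSMP n A \<longleftrightarrow> A \<in> carrier_mat n n \<and> (\<forall>X. nSMP_obstruction n A X \<longrightarrow> X = 0\<^sub>m n n)"
  unfolding nSMP_def nSMP_obstruction_def by blast

section \<open>Transposition and negation of real matrices\<close>

lemma minus_mat_eq_zero_iff:
  fixes A B :: "'a::ab_group_add mat"
  assumes "A \<in> carrier_mat n m" "B \<in> carrier_mat n m"
  shows "A - B = 0\<^sub>m n m \<longleftrightarrow> A = B"
  using assms by (auto simp: mat_eq_iff)

lemma mat_trace_transpose:
  "A \<in> carrier_mat n n \<Longrightarrow> mat_trace (transpose_mat A) = mat_trace A"
  by (auto simp: mat_trace_def)

lemma mat_trace_uminus:
  fixes A :: "real mat"
  shows "A \<in> carrier_mat n n \<Longrightarrow> mat_trace (- A) = - mat_trace A"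
  by (auto simp: mat_trace_def sum_negf)

text \<open>Transposing the commutation relation gives the one required of the new pair. In the
  trace conditions transposing reverses the product, and commutation of
  \<open>transpose_mat X\<close> with the powers of \<open>A\<close> restores the order.\<close>

lemma nSMP_obstruction_transpose:
  assumes "nSMP_obstruction n A X"
  shows "nSMP_obstruction n (transpose_mat A) (transpose_mat X)"
proof -
  have A: "A \<in> carrier_mat n n" and X: "X \<in> carrier_mat n n"
    and h: "hadamard_prod A X = 0\<^sub>m n n"
    and c: "A * transpose_mat X - transpose_mat X * A = 0\<^sub>m n n"
    and t: "\<And>k. k < n \<Longrightarrow> mat_trace (transpose_mat X * (A ^\<^sub>m k)) = 0"
    using assms by (auto simp: nSMP_obstruction_def)
  have XT: "transpose_mat X \<in> carrier_mat n n" using X by simp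
  have Ak: "A ^\<^sub>m k \<in> carrier_mat n n" for k using A by simp
  have comm: "A * transpose_mat X = transpose_mat X * A"
    using c minus_mat_eq_zero_iff[of "A * transpose_mat X" n n] A X by auto
  have comm_pow: "A ^\<^sub>m k * transpose_mat X = transpose_mat X * A ^\<^sub>m k" for k
  proof (induction k)
    case 0
    then show ?case using A X by simp
  next
    case (Suc k)
    have "A ^\<^sub>m Suc k * transpose_mat X = A ^\<^sub>m k * (A * transpose_mat X)"
      using assoc_mult_mat[OF Ak A XT] by simp
    also have "\<dots> = A ^\<^sub>m k * transpose_mat X * A"
      using assoc_mult_mat[OF Ak XT A] comm by simp
    also have "\<dots> = transpose_mat X * A ^\<^sub>m Suc k"
      using assoc_mult_mat[OF XT Ak A] Suc.IH by simp
    finally show ?case .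
  qed
  have pow: "transpose_mat (A ^\<^sub>m k) = transpose_mat A ^\<^sub>m k" for k
  proof (induction k)
    case (Suc k)
    \<comment> \<open>Powers grow by a factor on the right, while transposing reverses the factors,
      so the new factor is first moved to the left.\<close>
    have "A ^\<^sub>m Suc k = A * A ^\<^sub>m k"
    proof (induction k)
      case (Suc k)
      have "A ^\<^sub>m k \<in> carrier_mat n n" using A by simp
      with Suc show ?case using A assoc_mult_mat[of A n n "A ^\<^sub>m k" n A n] by simp
    qed (use A in simp)
    then show ?case using Suc.IH transpose_mult[OF A Ak] by simp
  qed (use A in auto)
  have "hadamard_prod (transpose_mat A) (transpose_mat X) = 0\<^sub>m n n"
  proof -
    have "A $$ (i, j) * X $$ (i, j) = 0" if "i < n" "j < n" for i j
      using arg_cong[OF h, of "\<lambda>M. M $$ (i, j)"] that A X by (simp add: hadamard_prod_def)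
    then show ?thesis using A X by (auto simp: hadamard_prod_def)
  qed
  moreover have "transpose_mat A * X = X * transpose_mat A"
    using arg_cong[OF comm, of transpose_mat] transpose_mult[OF A XT] transpose_mult[OF XT A]
    by simp
  moreover have "mat_trace (X * transpose_mat A ^\<^sub>m k) = 0" if "k < n" for k
  proof -
    have "mat_trace (X * transpose_mat A ^\<^sub>m k) = mat_trace (transpose_mat (A ^\<^sub>m k * transpose_mat X))"
      using transpose_mult[OF Ak XT] pow by simp
    also have "\<dots> = 0"
      using mat_trace_transpose[of "A ^\<^sub>m k * transpose_mat X" n] Ak XT t[OF that] comm_pow by simp
    finally show ?thesis .
  qed
  ultimately show ?thesis
    using A X minus_mat_eq_zero_iff[of "transpose_mat A * X" n n "X * transpose_mat A"]
    by (auto simp: nSMP_obstruction_def)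
qed

lemma nSMP_transpose_iff: "nSMP n (transpose_mat A) \<longleftrightarrow> nSMP n A"
proof -
  have *: "nSMP n B" if "nSMP n (transpose_mat B)" for B
    unfolding nSMP_iff_no_obstruction
  proof safe
    show B: "B \<in> carrier_mat n n" using that by (simp add: nSMP_def)
    fix X assume "nSMP_obstruction n B X"
    then have "transpose_mat X = 0\<^sub>m n n"
      using that nSMP_obstruction_transpose nSMP_iff_no_obstruction by blast
    then show "X = 0\<^sub>m n n"
      by (metis transpose_transpose zero_transpose_mat)
  qed
  from *[of A] *[of "transpose_mat A"] show ?thesis by auto
qed

lemma pow_mat_uminus:
  fixes A :: "real mat"
  assumes A: "A \<in> carrier_mat n n"
  shows "(- A) ^\<^sub>m k = (if even k then A ^\<^sub>m k else - (A ^\<^sub>m k))"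
proof (induction k)
  case (Suc k)
  have Ak: "A ^\<^sub>m k \<in> carrier_mat n n" using A by simp
  show ?case
    using Suc.IH A Ak by (simp add: uminus_mult_left_mat uminus_mult_right_mat)
qed (use A in auto)

text \<open>The same \<open>X\<close> serves: \<open>- A\<close> has the same zero entries, commutes
  with the same matrices, and its powers agree with those of \<open>A\<close> up to sign.\<close>

lemma nSMP_obstruction_uminus:
  assumes "nSMP_obstruction n A X"
  shows "nSMP_obstruction n (- A) X"
proof -
  have A: "A \<in> carrier_mat n n" and X: "X \<in> carrier_mat n n"
    and h: "hadamard_prod A X = 0\<^sub>m n n"
    and c: "A * transpose_mat X - transpose_mat X * A = 0\<^sub>m n n"
    and t: "\<And>k. k < n \<Longrightarrow> mat_trace (transpose_mat X * (A ^\<^sub>m k)) = 0"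
    using assms by (auto simp: nSMP_obstruction_def)
  have XT: "transpose_mat X \<in> carrier_mat n n" using X by simp
  have Ak: "A ^\<^sub>m k \<in> carrier_mat n n" for k using A by simp
  have comm: "A * transpose_mat X = transpose_mat X * A"
    using c minus_mat_eq_zero_iff[of "A * transpose_mat X" n n] A X by auto
  have "A $$ (i, j) * X $$ (i, j) = 0" if "i < n" "j < n" for i j
    using arg_cong[OF h, of "\<lambda>M. M $$ (i, j)"] that A X by (simp add: hadamard_prod_def)
  then have "hadamard_prod (- A) X = 0\<^sub>m n n"
    using A X by (auto simp: hadamard_prod_def)
  moreover have "- A * transpose_mat X = transpose_mat X * - A"
    using comm A XT by simp
  moreover have "mat_trace (transpose_mat X * (- A) ^\<^sub>m k) = 0" if "k < n" for k
    using t[OF that] mat_trace_uminus[of "transpose_mat X * A ^\<^sub>m k" n] A XT Ak[of k]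
    by (simp add: pow_mat_uminus)
  ultimately show ?thesis
    using A XT X minus_mat_eq_zero_iff[of "- A * transpose_mat X" n n "transpose_mat X * - A"]
    by (auto simp: nSMP_obstruction_def)
qed

lemma nSMP_uminus_iff: "nSMP n (- A) \<longleftrightarrow> nSMP n A"
proof -
  have *: "nSMP n B" if B: "nSMP n (- B)" for B
    unfolding nSMP_iff_no_obstruction
  proof safe
    show "B \<in> carrier_mat n n"
      using B by (simp only: nSMP_def uminus_carrier_iff_mat)
    fix X assume "nSMP_obstruction n B X"
    then have "nSMP_obstruction n (- B) X" by (rule nSMP_obstruction_uminus)
    then show "X = 0\<^sub>m n n" using B nSMP_iff_no_obstruction by blast
  qed
  have "- (- A) = A" by (rule eq_matI) auto
  with *[of A] *[of "- A"] show ?thesis by auto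
qed

section \<open>Similarity by signed permutation matrices, covering permutation and signature
  similarity at once\<close>

definition signed_permute_mat :: "(nat \<Rightarrow> nat) \<Rightarrow> (nat \<Rightarrow> 'a::times) \<Rightarrow> 'a mat \<Rightarrow> 'a mat" where
  "signed_permute_mat p s A =
     mat (dim_row A) (dim_col A) (\<lambda>(i, j). s i * A $$ (p i, p j) * s j)"

lemma signed_permute_mat_carrier [simp]:
  "A \<in> carrier_mat n m \<Longrightarrow> signed_permute_mat p s A \<in> carrier_mat n m"
  by (simp add: signed_permute_mat_def)

lemma permutes_lessThan_less: "p permutes {..<n} \<Longrightarrow> i < n \<Longrightarrow> p i < (n::nat)"
  using permutes_in_image[of p "{..<n}" i] by simp

context
  fixes n :: nat and p :: "nat \<Rightarrow> nat" and s :: "nat \<Rightarrow> real"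
  assumes p: "p permutes {..<n}" and s: "\<And>i. i < n \<Longrightarrow> s i * s i = 1"
begin

text \<open>The inner summation index is renamed along \<open>p\<close>, and the two signs
  \<open>s k\<close> that meet there cancel.\<close>

lemma signed_permute_mat_mult:
  assumes A: "A \<in> carrier_mat n n" and B: "B \<in> carrier_mat n n"
  shows "signed_permute_mat p s (A * B) = signed_permute_mat p s A * signed_permute_mat p s B"
proof (rule eq_matI)
  fix i j assume "i < dim_row (signed_permute_mat p s A * signed_permute_mat p s B)"
    "j < dim_col (signed_permute_mat p s A * signed_permute_mat p s B)"
  then have i: "i < n" and j: "j < n" using A B by (auto simp: signed_permute_mat_def)
  note pl = permutes_lessThan_less[OF p]
  have "signed_permute_mat p s (A * B) $$ (i, j) =
      s i * (\<Sum>k<n. A $$ (p i, k) * B $$ (k, p j)) * s j"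
    using A B i j pl[OF i] pl[OF j]
    by (simp add: signed_permute_mat_def scalar_prod_def lessThan_atLeast0)
  also have "(\<Sum>k<n. A $$ (p i, k) * B $$ (k, p j)) = (\<Sum>k<n. A $$ (p i, p k) * B $$ (p k, p j))"
    using sum.permute[OF p, of "\<lambda>k. A $$ (p i, k) * B $$ (k, p j)"] by (simp add: o_def)
  also have "s i * \<dots> * s j =
      (\<Sum>k<n. (s i * A $$ (p i, p k) * s k) * (s k * B $$ (p k, p j) * s j))"
    unfolding sum_distrib_left sum_distrib_right
  proof (rule sum.cong)
    fix k assume "k \<in> {..<n}"
    then have "s k * (s k * x) = x" for x
      using s by (simp flip: mult.assoc)
    then show "s i * (A $$ (p i, p k) * B $$ (p k, p j)) * s j =
        s i * A $$ (p i, p k) * s k * (s k * B $$ (p k, p j) * s j)"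
      by (simp add: mult_ac)
  qed simp
  also have "\<dots> = (signed_permute_mat p s A * signed_permute_mat p s B) $$ (i, j)"
    using A B i j
    by (simp add: signed_permute_mat_def scalar_prod_def lessThan_atLeast0)
  finally show "signed_permute_mat p s (A * B) $$ (i, j) =
      (signed_permute_mat p s A * signed_permute_mat p s B) $$ (i, j)" .
qed (use A B in \<open>auto simp: signed_permute_mat_def\<close>)

lemma signed_permute_mat_one: "signed_permute_mat p s (1\<^sub>m n) = 1\<^sub>m n"
  using s permutes_lessThan_less[OF p] permutes_inj[OF p]
  by (auto simp: signed_permute_mat_def inj_eq)

lemma signed_permute_mat_pow:
  assumes A: "A \<in> carrier_mat n n"
  shows "signed_permute_mat p s (A ^\<^sub>m k) = signed_permute_mat p s A ^\<^sub>m k"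
proof (induction k)
  case 0
  have "dim_row (signed_permute_mat p s A) = n" using A by (simp add: signed_permute_mat_def)
  then show ?case using A signed_permute_mat_one by simp
next
  case (Suc k)
  then show ?case using A signed_permute_mat_mult[of "A ^\<^sub>m k" A] by simp
qed

lemma mat_trace_signed_permute_mat:
  assumes A: "A \<in> carrier_mat n n"
  shows "mat_trace (signed_permute_mat p s A) = mat_trace A"
proof -
  have "mat_trace (signed_permute_mat p s A) = (\<Sum>i<n. A $$ (p i, p i))"
    unfolding mat_trace_def
  proof (rule sum.cong)
    fix i assume "i \<in> {..<n}"
    with s[of i] show "signed_permute_mat p s A $$ (i, i) = A $$ (p i, p i)"
      using A by (simp add: signed_permute_mat_def algebra_simps)
  qed (use A in \<open>simp add: signed_permute_mat_def\<close>)
  also have "\<dots> = mat_trace A"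
    using sum.permute[OF p, of "\<lambda>i. A $$ (i, i)"] A by (simp add: mat_trace_def o_def)
  finally show ?thesis .
qed

text \<open>A signed permutation matrix is orthogonal, so the similarity respects transposition as
  well as products, powers and traces; the zero positions of \<open>A\<close> and \<open>X\<close>
  move together.\<close>

lemma nSMP_obstruction_signed_permute_mat:
  assumes "nSMP_obstruction n A X"
  shows "nSMP_obstruction n (signed_permute_mat p s A) (signed_permute_mat p s X)"
proof -
  have A: "A \<in> carrier_mat n n" and X: "X \<in> carrier_mat n n"
    and h: "hadamard_prod A X = 0\<^sub>m n n"
    and c: "A * transpose_mat X - transpose_mat X * A = 0\<^sub>m n n"
    and t: "\<And>k. k < n \<Longrightarrow> mat_trace (transpose_mat X * (A ^\<^sub>m k)) = 0"
    using assms by (auto simp: nSMP_obstruction_def)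
  let ?\<phi> = "signed_permute_mat p s"
  note pl = permutes_lessThan_less[OF p]
  have XT: "transpose_mat X \<in> carrier_mat n n" using X by simp
  have Ak: "A ^\<^sub>m k \<in> carrier_mat n n" for k using A by simp
  have tr: "transpose_mat (?\<phi> X) = ?\<phi> (transpose_mat X)"
    using X pl by (auto simp: signed_permute_mat_def)
  have comm: "A * transpose_mat X = transpose_mat X * A"
    using c minus_mat_eq_zero_iff[of "A * transpose_mat X" n n] A X by auto
  have "A $$ (i, j) * X $$ (i, j) = 0" if "i < n" "j < n" for i j
    using arg_cong[OF h, of "\<lambda>M. M $$ (i, j)"] that A X by (simp add: hadamard_prod_def)
  then have "A $$ (p i, p j) = 0 \<or> X $$ (p i, p j) = 0" if "i < n" "j < n" for i j
    using pl that by (simp only: mult_eq_0_iff[symmetric])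
  then have "hadamard_prod (?\<phi> A) (?\<phi> X) = 0\<^sub>m n n"
    using A X by (intro eq_matI) (fastforce simp: hadamard_prod_def signed_permute_mat_def)+
  moreover have "?\<phi> A * transpose_mat (?\<phi> X) = transpose_mat (?\<phi> X) * ?\<phi> A"
    using comm signed_permute_mat_mult[OF A XT] signed_permute_mat_mult[OF XT A] tr by simp
  moreover have "mat_trace (transpose_mat (?\<phi> X) * ?\<phi> A ^\<^sub>m k) = 0" if "k < n" for k
    using t[OF that] tr signed_permute_mat_mult[OF XT Ak] signed_permute_mat_pow[OF A]
      mat_trace_signed_permute_mat[of "transpose_mat X * A ^\<^sub>m k"] XT Ak[of k] by simp
  ultimately show ?thesis
    using A X minus_mat_eq_zero_iff[of "?\<phi> A * transpose_mat (?\<phi> X)" n n "transpose_mat (?\<phi> X) * ?\<phi> A"]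
      signed_permute_mat_carrier[OF A, of p s] signed_permute_mat_carrier[OF X, of p s]
    by (auto simp: nSMP_obstruction_def simp del: signed_permute_mat_carrier)
qed

lemma signed_permute_mat_eq_zero:
  assumes X: "X \<in> carrier_mat n n" and z: "signed_permute_mat p s X = 0\<^sub>m n n"
  shows "X = 0\<^sub>m n n"
proof (rule eq_matI)
  fix i j assume "i < dim_row (0\<^sub>m n n :: real mat)" "j < dim_col (0\<^sub>m n n :: real mat)"
  then have "i < n" "j < n" by auto
  then obtain k l where kl: "k < n" "l < n" "i = p k" "j = p l"
    using permutes_image[OF p] by (metis (no_types, lifting) image_iff lessThan_iff)
  have "s k * X $$ (p k, p l) * s l = 0"
    using arg_cong[OF z, of "\<lambda>M. M $$ (k, l)"] kl X by (simp add: signed_permute_mat_def)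
  moreover have "s k \<noteq> 0" "s l \<noteq> 0" using s[of k] s[of l] kl by auto
  ultimately show "X $$ (i, j) = (0\<^sub>m n n) $$ (i, j)"
    using \<open>i < n\<close> \<open>j < n\<close> kl by simp
qed (use X in auto)

lemma nSMP_of_nSMP_signed_permute_mat:
  assumes A: "A \<in> carrier_mat n n" and "nSMP n (signed_permute_mat p s A)"
  shows "nSMP n A"
  using assms nSMP_obstruction_signed_permute_mat signed_permute_mat_eq_zero
  unfolding nSMP_iff_no_obstruction by (metis nSMP_obstruction_def)

end

lemma nSMP_signed_permute_mat_iff:
  assumes p: "p permutes {..<n}" and s: "\<And>i. i < n \<Longrightarrow> s i * s i = 1"
    and A: "A \<in> carrier_mat n n"
  shows "nSMP n (signed_permute_mat p s A) \<longleftrightarrow> nSMP n A"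
proof
  assume "nSMP n (signed_permute_mat p s A)"
  then show "nSMP n A" using nSMP_of_nSMP_signed_permute_mat[where p=p and s=s] p s A by blast
next
  assume nA: "nSMP n A"
  \<comment> \<open>The inverse similarity is of the same kind, with the signs carried along the
    inverse permutation.\<close>
  let ?q = "Hilbert_Choice.inv p" and ?t = "\<lambda>i. s (Hilbert_Choice.inv p i)"
  have q: "?q permutes {..<n}" using p by (rule permutes_inv)
  note ql = permutes_lessThan_less[OF q]
  have t: "?t i * ?t i = 1" if "i < n" for i using s ql that by simp
  have "signed_permute_mat ?q ?t (signed_permute_mat p s A) = A"
  proof (rule eq_matI)
    fix i j assume "i < dim_row A" "j < dim_col A"
    then have ij: "i < n" "j < n" using A by auto
    have "signed_permute_mat ?q ?t (signed_permute_mat p s A) $$ (i, j) =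
        ?t i * (?t i * A $$ (i, j) * ?t j) * ?t j"
      using A ij ql by (simp add: signed_permute_mat_def permutes_inverses[OF p])
    also have "\<dots> = (?t i * ?t i) * A $$ (i, j) * (?t j * ?t j)"
      by (simp only: mult_ac)
    also have "\<dots> = A $$ (i, j)" using t ij by simp
    finally show "signed_permute_mat ?q ?t (signed_permute_mat p s A) $$ (i, j) = A $$ (i, j)" .
  qed (simp_all add: signed_permute_mat_def)
  then show "nSMP n (signed_permute_mat p s A)"
    using nSMP_of_nSMP_signed_permute_mat[where p="?q" and s="?t" and A="signed_permute_mat p s A"] q t A nA by simp
qed

section \<open>Transfer of the nSMP along equivalence steps of sign patterns\<close>

lemma permute_mat_carrier [simp]: "A \<in> carrier_mat n m \<Longrightarrow> permute_mat p A \<in> carrier_mat n m"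
  by (simp add: permute_mat_def)

lemma permute_mat_inverse:
  assumes p: "p permutes {..<n}" and A: "A \<in> carrier_mat n n"
  shows "permute_mat (Hilbert_Choice.inv p) (permute_mat p A) = A"
  using A permutes_lessThan_less[OF permutes_inv[OF p]]
  by (auto simp: permute_mat_def permutes_inverses[OF p])

lemma sign_neg_neg [simp]: "sign_neg (sign_neg x) = x"
  by (cases x) auto

lemma sign_mult_Pos_right: "sign_mult x Pos = x"
  by (cases x) auto

lemma sign_mult_Neg_right: "sign_mult x Neg = sign_neg x"
  by (cases x) auto

lemma signature_mat_involutive:
  assumes d: "\<forall>i<n. d i \<in> {Pos, Neg}" and A: "A \<in> carrier_mat n n"
  shows "signature_mat d (signature_mat d A) = A"
proof (rule eq_matI)
  fix i j assume ij: "i < dim_row A" "j < dim_col A"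
  then have "d i \<in> {Pos, Neg}" "d j \<in> {Pos, Neg}" using d A by auto
  then show "signature_mat d (signature_mat d A) $$ (i, j) = A $$ (i, j)"
    using ij by (auto simp: signature_mat_def sign_mult_Pos_right sign_mult_Neg_right)
qed (auto simp: signature_mat_def)

lemma pattern_step_carrier:
  "pattern_step n A B \<Longrightarrow> A \<in> carrier_mat n n \<Longrightarrow> B \<in> carrier_mat n n"
  by (cases rule: pattern_step.cases) (auto simp: signature_mat_def)

text \<open>Reversibility lets a one-sided statement about realizations be used in both
  directions.\<close>

lemma pattern_step_sym:
  assumes "pattern_step n A B" "A \<in> carrier_mat n n"
  shows "pattern_step n B A"
  using assms
proof (cases rule: pattern_step.cases)
  case (permutation p)
  then show ?thesis
    using pattern_step.permutation[OF permutes_inv[of p], of n B] permute_mat_inverse assms(2) by metis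
next
  case (signature d)
  then show ?thesis
    using pattern_step.signature[of n d B] signature_mat_involutive assms(2) by metis
next
  case transposition
  then show ?thesis using pattern_step.transposition[of n B] by simp
next
  case negation
  have "map_mat sign_neg B = A" using negation by (auto intro!: eq_matI)
  then show ?thesis using pattern_step.negation[of n B] by simp
qed

lemma Q_class_iff:
  assumes "A \<in> carrier_mat n n"
  shows "M \<in> Q_class A \<longleftrightarrow> M \<in> carrier_mat n n \<and> (\<forall>i<n. \<forall>j<n. M $$ (i, j) \<in> sign_set (A $$ (i, j)))"
  using assms by (auto simp: Q_class_def pattern_class_def)

lemma sign_set_neg: "x \<in> sign_set s \<Longrightarrow> - x \<in> sign_set (sign_neg s)"
  by (cases s) auto

text \<open>The operation applied to the pattern is applied to the realization, and the real matrix
  invariances above give the equivalence. Used for a step and for its reverse, this transfers both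
  quantifiers over realizations.\<close>

lemma pattern_step_realization:
  assumes "pattern_step n A B" and A: "A \<in> carrier_mat n n" and M: "M \<in> Q_class A"
  shows "\<exists>N \<in> Q_class B. nSMP n N \<longleftrightarrow> nSMP n M"
proof -
  note B = pattern_step_carrier[OF assms(1) A]
  have Mc: "M \<in> carrier_mat n n"
    and Ms: "\<And>i j. i < n \<Longrightarrow> j < n \<Longrightarrow> M $$ (i, j) \<in> sign_set (A $$ (i, j))"
    using M Q_class_iff[OF A] by auto
  from assms(1) show ?thesis
  proof (cases rule: pattern_step.cases)
    case (permutation p)
    have "signed_permute_mat p (\<lambda>_. 1) M \<in> Q_class B"
      unfolding Q_class_iff[OF B] using permutation Mc A Ms permutes_lessThan_less[of p n]
      by (auto simp: permute_mat_def signed_permute_mat_def)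
    then show ?thesis
      using nSMP_signed_permute_mat_iff[of p n "\<lambda>_. 1" M] permutation Mc by auto
  next
    case (signature d)
    \<comment> \<open>Everything other than \<open>Pos\<close> is sent to \<open>- 1\<close>, so
      that \<open>s i * s i = 1\<close> holds for every \<open>i\<close>.\<close>
    define s :: "nat \<Rightarrow> real" where "s i = (if d i = Pos then 1 else - 1)" for i
    have "s i * M $$ (i, j) * s j \<in> sign_set (sign_mult (sign_mult (d i) (A $$ (i, j))) (d j))"
      if ij: "i < n" "j < n" for i j
    proof -
      have "d i \<in> {Pos, Neg}" "d j \<in> {Pos, Neg}" using signature ij by auto
      then show ?thesis using Ms[OF ij] sign_set_neg[OF Ms[OF ij]]
        by (auto simp: s_def sign_mult_Pos_right sign_mult_Neg_right)
    qed
    then have "signed_permute_mat id s M \<in> Q_class B"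
      unfolding Q_class_iff[OF B] using signature Mc A
      by (auto simp: signature_mat_def signed_permute_mat_def)
    moreover have "nSMP n (signed_permute_mat id s M) \<longleftrightarrow> nSMP n M"
      by (rule nSMP_signed_permute_mat_iff) (auto simp: s_def permutes_id Mc)
    ultimately show ?thesis by blast
  next
    case transposition
    have "transpose_mat M \<in> Q_class B"
      unfolding Q_class_iff[OF B] using transposition Mc A Ms by auto
    then show ?thesis using nSMP_transpose_iff by blast
  next
    case negation
    have "- M \<in> Q_class B"
      unfolding Q_class_iff[OF B] using negation Mc A Ms sign_set_neg by auto
    then show ?thesis using nSMP_uminus_iff by blast
  qed
qed

lemma pattern_step_allows_requires:
  assumes "pattern_step n A B" "A \<in> carrier_mat n n"
  shows "allows A (nSMP n) \<longleftrightarrow> allows B (nSMP n)"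
    and "requires A (nSMP n) \<longleftrightarrow> requires B (nSMP n)"
proof -
  note BA = pattern_step_sym[OF assms] pattern_step_carrier[OF assms]
  show "allows A (nSMP n) \<longleftrightarrow> allows B (nSMP n)"
    unfolding allows_def
    using pattern_step_realization[OF assms] pattern_step_realization[OF BA] by blast
  show "requires A (nSMP n) \<longleftrightarrow> requires B (nSMP n)"
    unfolding requires_def
    using pattern_step_realization[OF assms] pattern_step_realization[OF BA] by blast
qed

lemma equivalent_patterns_allows_requires:
  assumes "equivalent_patterns n A B" "A \<in> carrier_mat n n"
  shows "allows A (nSMP n) \<longleftrightarrow> allows B (nSMP n)"
    and "requires A (nSMP n) \<longleftrightarrow> requires B (nSMP n)"
proof -
  have "B \<in> carrier_mat n n \<and> (allows A (nSMP n) \<longleftrightarrow> allows B (nSMP n)) \<and>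
      (requires A (nSMP n) \<longleftrightarrow> requires B (nSMP n))"
    using assms(1)[unfolded equivalent_patterns_def]
  proof (induction rule: rtranclp_induct)
    case (step B C)
    then show ?case using pattern_step_carrier pattern_step_allows_requires by blast
  qed (use assms in simp)
  then show "allows A (nSMP n) \<longleftrightarrow> allows B (nSMP n)"
    and "requires A (nSMP n) \<longleftrightarrow> requires B (nSMP n)" by blast+
qed

lemma equivalent_to_signing_of_step:
  assumes "pattern_step n A B" "equivalent_to_signing_of n B P"
  shows "equivalent_to_signing_of n A P"
  using assms unfolding equivalent_to_signing_of_def equivalent_patterns_def
  by (meson converse_rtranclp_into_rtranclp)

subsection \<open>Block triangular real matrices\<close>

abbreviation (input) mat3 :: "'a \<Rightarrow> 'a \<Rightarrow> 'a \<Rightarrow> 'a \<Rightarrow> 'a \<Rightarrow> 'a \<Rightarrow> 'a \<Rightarrow> 'a \<Rightarrow> 'a \<Rightarrow> 'a mat" where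
  "mat3 a b c d e f g h i \<equiv> mat_of_rows_list 3 [[a, b, c], [d, e, f], [g, h, i]]"

lemma less_3_iff: "i < (3::nat) \<longleftrightarrow> i = 0 \<or> i = 1 \<or> i = 2"
  by auto

lemma all_less_3: "(\<forall>i<3::nat. P i) \<longleftrightarrow> P 0 \<and> P 1 \<and> P 2"
  by (auto simp: less_3_iff)

lemma sum_lessThan_3: "(\<Sum>i<3::nat. f i) = f 0 + f 1 + (f 2 :: 'a::comm_monoid_add)"
  by (simp add: eval_nat_numeral lessThan_Suc ac_simps)

lemma mat3_dim [simp]: "dim_row (mat3 a b c d e f g h i) = 3" "dim_col (mat3 a b c d e f g h i) = 3"
  by (simp_all add: mat_of_rows_list_def)

lemma mat3_carrier [simp]: "mat3 a b c d e f g h i \<in> carrier_mat 3 3"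
  by (simp add: carrier_matI)

lemma mat3_index:
  "mat3 a b c d e f g h i $$ (0, 0) = a" "mat3 a b c d e f g h i $$ (0, 1) = b"
  "mat3 a b c d e f g h i $$ (0, 2) = c" "mat3 a b c d e f g h i $$ (1, 0) = d"
  "mat3 a b c d e f g h i $$ (1, 1) = e" "mat3 a b c d e f g h i $$ (1, 2) = f"
  "mat3 a b c d e f g h i $$ (2, 0) = g" "mat3 a b c d e f g h i $$ (2, 1) = h"
  "mat3 a b c d e f g h i $$ (2, 2) = i"
  by (simp_all add: mat_of_rows_list_def)

lemma mat3_eta:
  assumes "M \<in> carrier_mat 3 3"
  shows "M = mat3 (M $$ (0, 0)) (M $$ (0, 1)) (M $$ (0, 2)) (M $$ (1, 0)) (M $$ (1, 1))
    (M $$ (1, 2)) (M $$ (2, 0)) (M $$ (2, 1)) (M $$ (2, 2))" (is "_ = ?N")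
proof (rule eq_matI)
  fix i j assume "i < dim_row ?N" "j < dim_col ?N"
  then have "i = 0 \<or> i = 1 \<or> i = 2" "j = 0 \<or> j = 1 \<or> j = 2" by (auto simp: less_3_iff)
  then show "M $$ (i, j) = ?N $$ (i, j)" using mat3_index by metis
qed (use assms in auto)

lemma mat3_eqI:
  assumes "M \<in> carrier_mat 3 3"
    and "M $$ (0, 0) = a" "M $$ (0, 1) = b" "M $$ (0, 2) = c" "M $$ (1, 0) = d" "M $$ (1, 1) = e"
      "M $$ (1, 2) = f" "M $$ (2, 0) = g" "M $$ (2, 1) = h" "M $$ (2, 2) = i"
  shows "M = mat3 a b c d e f g h i"
  using mat3_eta[OF assms(1)] assms(2-) by simp

lemma mat3_exhaust:
  assumes "M \<in> carrier_mat 3 3"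
  obtains a b c d e f g h i where "M = mat3 a b c d e f g h i"
  using mat3_eta[OF assms] by metis

lemma mat3_eq_iff:
  "mat3 a b c d e f g h i = mat3 a' b' c' d' e' f' g' h' i' \<longleftrightarrow>
   a = a' \<and> b = b' \<and> c = c' \<and> d = d' \<and> e = e' \<and> f = f' \<and> g = g' \<and> h = h' \<and> i = i'"
  using mat3_index by metis

lemma mat3_transpose:
  "transpose_mat (mat3 a b c d e f g h i) = mat3 a d g b e h c f i"
  by (rule mat3_eqI) (simp_all add: mat3_index flip: One_nat_def)

lemma mat3_map: "map_mat u (mat3 a b c d e f g h i) =
    mat3 (u a) (u b) (u c) (u d) (u e) (u f) (u g) (u h) (u i)"
  by (rule mat3_eqI) (simp_all add: mat3_index flip: One_nat_def)

lemma mat3_mult: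
  fixes a :: "'a::semiring_0"
  shows "mat3 a b c d e f g h i * mat3 a' b' c' d' e' f' g' h' i' =
    mat3 (a * a' + b * d' + c * g') (a * b' + b * e' + c * h') (a * c' + b * f' + c * i')
      (d * a' + e * d' + f * g') (d * b' + e * e' + f * h') (d * c' + e * f' + f * i')
      (g * a' + h * d' + i * g') (g * b' + h * e' + i * h') (g * c' + h * f' + i * i')"
  by (rule mat3_eqI) (simp_all add: mat3_index scalar_prod_def sum_lessThan_3 carrier_matI
      flip: One_nat_def lessThan_atLeast0)

lemma mat3_minus:
  fixes a :: "'a::minus"
  shows "mat3 a b c d e f g h i - mat3 a' b' c' d' e' f' g' h' i' =
    mat3 (a - a') (b - b') (c - c') (d - d') (e - e') (f - f') (g - g') (h - h') (i - i')"
  by (rule mat3_eqI) (simp_all add: mat3_index carrier_matI flip: One_nat_def)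

lemma mat3_zero: "0\<^sub>m 3 3 = mat3 0 0 0 0 0 0 0 0 (0::'a::zero)"
  by (rule mat3_eqI) simp_all

lemma mat3_one: "1\<^sub>m 3 = mat3 1 0 0 0 1 0 0 0 (1::'a::{zero,one})"
  by (rule mat3_eqI) simp_all

lemma mat3_hadamard:
  "hadamard_prod (mat3 a b c d e f g h i) (mat3 a' b' c' d' e' f' g' h' i') =
    mat3 (a * a') (b * b') (c * c') (d * d') (e * e') (f * f') (g * g') (h * h') (i * i')"
  by (rule mat3_eqI) (simp_all add: hadamard_prod_def mat3_index flip: One_nat_def)

lemma mat3_trace: "mat_trace (mat3 a b c d e f g h i) = a + e + (i::'a::comm_monoid_add)"
  by (simp add: mat_trace_def sum_lessThan_3 mat3_index flip: One_nat_def)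

section \<open>The nSMP criterion for block triangular matrices\<close>

text \<open>The candidate \<open>X\<close> is written through the entries of its transpose \<open>Y\<close>, which commutes
  with the matrix.\<close>

lemma nSMP_obstruction_block_iff:
  "nSMP_obstruction 3 (mat3 a b c e f g 0 0 d) (mat3 y1 y4 y7 y2 y5 y8 y3 y6 y9) \<longleftrightarrow>
     a * y1 = 0 \<and> b * y4 = 0 \<and> c * y7 = 0 \<and> e * y2 = 0 \<and> f * y5 = 0 \<and> g * y8 = 0 \<and> d * y9 = 0 \<and>
     a * y1 + b * y4 + c * y7 = y1 * a + y2 * e \<and>
     a * y2 + b * y5 + c * y8 = y1 * b + y2 * f \<and>
     a * y3 + b * y6 + c * y9 = y1 * c + y2 * g + y3 * d \<and>
     e * y1 + f * y4 + g * y7 = y4 * a + y5 * e \<and>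
     e * y2 + f * y5 + g * y8 = y4 * b + y5 * f \<and>
     e * y3 + f * y6 + g * y9 = y4 * c + y5 * g + y6 * d \<and>
     d * y7 = y7 * a + y8 * e \<and>
     d * y8 = y7 * b + y8 * f \<and>
     d * y9 = y7 * c + y8 * g + y9 * d \<and>
     y1 + y5 + y9 = 0 \<and>
     (y1 * a + y2 * e) + (y4 * b + y5 * f) + (y7 * c + y8 * g + y9 * d) = 0 \<and>
     (y1 * (a * a + b * e) + y2 * (e * a + f * e)) +
     (y4 * (a * b + b * f) + y5 * (e * b + f * f)) +
     (y7 * (a * c + b * g + c * d) + y8 * (e * c + f * g + g * d) + y9 * (d * d)) = 0"
proof -
  let ?A = "mat3 a b c e f g 0 0 d" and ?X = "mat3 y1 y4 y7 y2 y5 y8 y3 y6 y9"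
  let ?Y = "mat3 y1 y2 y3 y4 y5 y6 y7 y8 y9"
  have Y: "transpose_mat ?X = ?Y" by (rule mat3_transpose)
  have hadamard: "hadamard_prod ?A ?X = 0\<^sub>m 3 3 \<longleftrightarrow>
     a * y1 = 0 \<and> b * y4 = 0 \<and> c * y7 = 0 \<and> e * y2 = 0 \<and> f * y5 = 0 \<and> g * y8 = 0 \<and> d * y9 = 0"
    by (simp only: mat3_hadamard mat3_zero mat3_eq_iff mult_zero_left simp_thms)
  have commute: "?A * ?Y - ?Y * ?A = 0\<^sub>m 3 3 \<longleftrightarrow>
     a * y1 + b * y4 + c * y7 = y1 * a + y2 * e \<and>
     a * y2 + b * y5 + c * y8 = y1 * b + y2 * f \<and>
     a * y3 + b * y6 + c * y9 = y1 * c + y2 * g + y3 * d \<and>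
     e * y1 + f * y4 + g * y7 = y4 * a + y5 * e \<and>
     e * y2 + f * y5 + g * y8 = y4 * b + y5 * f \<and>
     e * y3 + f * y6 + g * y9 = y4 * c + y5 * g + y6 * d \<and>
     d * y7 = y7 * a + y8 * e \<and>
     d * y8 = y7 * b + y8 * f \<and>
     d * y9 = y7 * c + y8 * g + y9 * d"
    by (simp only: mat3_mult mat3_minus mat3_zero mat3_eq_iff right_minus_eq
        mult_zero_left mult_zero_right add_0_left add_0_right)
  have powers: "?A ^\<^sub>m 0 = 1\<^sub>m 3" "?A ^\<^sub>m 1 = ?A" "?A ^\<^sub>m 2 = ?A * ?A"
    by (simp_all add: numeral_2_eq_2)
  have traces: "(\<forall>k<3. mat_trace (?Y * ?A ^\<^sub>m k) = 0) \<longleftrightarrow>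
     y1 + y5 + y9 = 0 \<and>
     (y1 * a + y2 * e) + (y4 * b + y5 * f) + (y7 * c + y8 * g + y9 * d) = 0 \<and>
     (y1 * (a * a + b * e) + y2 * (e * a + f * e)) +
     (y4 * (a * b + b * f) + y5 * (e * b + f * f)) +
     (y7 * (a * c + b * g + c * d) + y8 * (e * c + f * g + g * d) + y9 * (d * d)) = 0"
    by (simp only: all_less_3 powers mat3_one mat3_mult mat3_trace
        mult_zero_left mult_zero_right mult_1_right add_0_left add_0_right)
  show ?thesis
    by (simp only: nSMP_obstruction_def Y hadamard commute traces mat3_carrier conj_assoc simp_thms)
qed

text \<open>Cramer's rule: the adjugate turns the two equations into the determinant times
  \<open>u\<close> and times \<open>v\<close>.\<close>

lemma kernel_2_trivial:
  fixes p q r s u v :: real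
  assumes u: "u * p + v * r = 0" and v: "u * q + v * s = 0" and det: "p * s - q * r \<noteq> 0"
  shows "u = 0 \<and> v = 0"
proof -
  have "(p * s - q * r) * u = s * (u * p + v * r) - r * (u * q + v * s)"
    "(p * s - q * r) * v = p * (u * q + v * s) - q * (u * p + v * r)"
    by (simp_all add: algebra_simps)
  then have "(p * s - q * r) * u = 0" "(p * s - q * r) * v = 0"
    unfolding u v by simp_all
  then show ?thesis using det by simp
qed

text \<open>The first condition says that the characteristic polynomial of the leading block does
  not vanish at \<open>d\<close>; the second excludes a triangular leading block with a double
  eigenvalue. Failure of either yields an explicit obstruction. If both hold, the entries of
  \<open>transpose_mat X\<close> vanish in turn: bottom row, leading block, last column.\<close>

lemma nSMP_block_iff:
  fixes a b c d e f g :: real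
  shows "nSMP 3 (mat3 a b c e f g 0 0 d) \<longleftrightarrow>
    (a - d) * (f - d) \<noteq> b * e \<and> (b * e \<noteq> 0 \<or> a \<noteq> f)"
proof (intro iffI conjI)
  assume nS: "nSMP 3 (mat3 a b c e f g 0 0 d)"
  \<comment> \<open>The variables are instantiated in their order of occurrence, so the numbers
    given to \<open>no\<close> below are the entries of \<open>X\<close> row by row. Every witness
    used is nonzero in one of the four entries named.\<close>
  have no: False
    if "nSMP_obstruction 3 (mat3 a b c e f g 0 0 d) (mat3 y1 y4 y7 y2 y5 y8 y3 y6 y9)"
      "y2 \<noteq> 0 \<or> y3 \<noteq> 0 \<or> y4 \<noteq> 0 \<or> y6 \<noteq> 0" for y1 y2 y3 y4 y5 y6 y7 y8 y9
    using nS that unfolding nSMP_iff_no_obstruction by (auto simp: mat3_zero mat3_eq_iff)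
  show det: "(a - d) * (f - d) \<noteq> b * e"
  proof
    assume det0: "(a - d) * (f - d) = b * e"
    \<comment> \<open>An eigenvector of the leading block for \<open>d\<close>. If the first row of
      the block minus \<open>d\<close> is nonzero, \<open>(b, d - a)\<close> is annihilated by it,
      and by the second row because the determinant vanishes. If only the second row is nonzero,
      \<open>(d - f, e)\<close> works; otherwise any vector does.\<close>
    obtain v w where v: "v \<noteq> 0 \<or> w \<noteq> 0" "a * v + b * w = v * d" "e * v + f * w = w * d"
    proof (cases "b = 0 \<and> a = d")
      case True
      show ?thesis
      proof (cases "e = 0 \<and> f = d")
        case True
        with \<open>b = 0 \<and> a = d\<close> show ?thesis using that[of 1 0] by simp
      next
        case False
        with True show ?thesis using that[of "d - f" e] by (auto simp: algebra_simps)
      qed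
    next
      case False
      then show ?thesis using that[of b "d - a"] det0 by (auto simp: algebra_simps)
    qed
    \<comment> \<open>The eigenvector becomes the last row of \<open>X\<close>, where the matrix has
      its zero block; all traces then vanish.\<close>
    show False
      by (rule no[of 0 0 0 0 0 0 v w 0]) (use v in \<open>auto simp: nSMP_obstruction_block_iff\<close>)
  qed
  show "b * e \<noteq> 0 \<or> a \<noteq> f"
  proof (rule ccontr)
    assume "\<not> (b * e \<noteq> 0 \<or> a \<noteq> f)"
    then have be: "b = 0 \<or> e = 0" and af: "f = a" by auto
    with det have ad: "a - d \<noteq> 0" by auto
    from be show False
    proof
      assume "e = 0"
      \<comment> \<open>For \<open>e = 0\<close> and \<open>a = f\<close> the upper off-diagonal
        matrix unit commutes with the leading block. The entry \<open>g / (a - d)\<close> in the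
        last column of \<open>transpose_mat X\<close> extends this to the whole matrix. The case
        \<open>b = 0\<close> is symmetric, with \<open>c\<close> in place of
        \<open>g\<close>.\<close>
      show False
        by (rule no[of 0 0 0 1 0 0 "g / (a - d)" 0 0])
          (use \<open>e = 0\<close> af ad in \<open>auto simp: nSMP_obstruction_block_iff field_simps\<close>)
    next
      assume "b = 0"
      show False
        by (rule no[of 0 1 0 0 0 0 0 "c / (a - d)" 0])
          (use \<open>b = 0\<close> af ad in \<open>auto simp: nSMP_obstruction_block_iff field_simps\<close>)
    qed
  qed
next
  assume "(a - d) * (f - d) \<noteq> b * e \<and> (b * e \<noteq> 0 \<or> a \<noteq> f)"
  then have det: "(a - d) * (f - d) - b * e \<noteq> 0" and be: "b * e \<noteq> 0 \<or> a \<noteq> f" by auto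
  \<comment> \<open>The leading block has neither a left nor a right eigenvector for
    \<open>d\<close>. The left version disposes of the bottom row of \<open>transpose_mat X\<close>,
    the right version of its last column.\<close>
  have ker_left: "u = 0 \<and> v = 0" if "d * u = u * a + v * e" "d * v = u * b + v * f" for u v
    using kernel_2_trivial[of u "a - d" v e b "f - d"] that det by (simp add: algebra_simps)
  have ker_right: "u = 0 \<and> v = 0" if "a * u + b * v = u * d" "e * u + f * v = v * d" for u v
    using kernel_2_trivial[of u "a - d" v b e "f - d"] that det by (simp add: algebra_simps)
  show "nSMP 3 (mat3 a b c e f g 0 0 d)"
    unfolding nSMP_iff_no_obstruction
  proof (intro conjI allI impI)
    fix X assume X: "nSMP_obstruction 3 (mat3 a b c e f g 0 0 d) X"
    then obtain y1 y2 y3 y4 y5 y6 y7 y8 y9 where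
      X_eq: "X = mat3 y1 y4 y7 y2 y5 y8 y3 y6 y9"
      by (meson mat3_exhaust nSMP_obstruction_def)
    note eqs = X[unfolded X_eq nSMP_obstruction_block_iff]
    have y78: "y7 = 0" "y8 = 0" using ker_left[of y7 y8] eqs by blast+
    have tr0: "y1 + y5 + y9 = 0"
      and tr1: "(y1 * a + y2 * e) + (y4 * b + y5 * f) + y9 * d = 0"
      and tr2: "(y1 * (a * a + b * e) + y2 * (e * a + f * e)) +
         (y4 * (a * b + b * f) + y5 * (e * b + f * f)) + y9 * (d * d) = 0"
      using eqs y78 by auto
    \<comment> \<open>Cayley--Hamilton for the leading block kills the contributions of \<open>y1\<close>, \<open>y2\<close>, \<open>y4\<close>, \<open>y5\<close>.\<close>
    have "((a - d) * (f - d) - b * e) * y9 =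
        ((y1 * (a * a + b * e) + y2 * (e * a + f * e)) +
         (y4 * (a * b + b * f) + y5 * (e * b + f * f)) + y9 * (d * d))
        - (a + f) * ((y1 * a + y2 * e) + (y4 * b + y5 * f) + y9 * d)
        + (a * f - b * e) * (y1 + y5 + y9)"
      by (simp add: algebra_simps)
    also have "\<dots> = 0" unfolding tr0 tr1 tr2 by simp
    finally have "((a - d) * (f - d) - b * e) * y9 = 0" .
    then have y9: "y9 = 0" using det by simp
    have had: "a * y1 = 0" "b * y4 = 0" "e * y2 = 0" "f * y5 = 0"
      and comm: "b * y4 = y2 * e" "a * y2 + b * y5 = y1 * b + y2 * f"
         "e * y1 + f * y4 = y4 * a + y5 * e"
      using eqs y78 by auto
    have y5: "y5 = - y1" using tr0 y9 by simp
    \<comment> \<open>If \<open>b * e\<close> is nonzero, the entrywise product kills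
      \<open>y2\<close> and \<open>y4\<close>, and commutation gives \<open>y1 = y5\<close>, against
      \<open>y5 = - y1\<close>. Otherwise \<open>a\<close> and \<open>f\<close> differ: the diagonal
      conditions \<open>a * y1 = 0\<close> and \<open>f * y5 = 0\<close> give
      \<open>(a - f) * y1 = 0\<close>, after which commutation kills \<open>y2\<close> and
      \<open>y4\<close>.\<close>
    have y124: "y1 = 0 \<and> y2 = 0 \<and> y4 = 0"
    proof (cases "b * e = 0")
      case False
      then have "y4 = 0" "y2 = 0" using had by auto
      then show ?thesis using False comm y5 by auto
    next
      case True
      then have af: "a - f \<noteq> 0" using be by simp
      have "(a - f) * y1 = 0" using had y5 by (auto simp: algebra_simps)
      then have y1: "y1 = 0" using af by simp
      have "(a - f) * y2 = 0" "(a - f) * y4 = 0"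
        using comm y1 y5 by (auto simp: algebra_simps)
      then show ?thesis using y1 af by simp
    qed
    \<comment> \<open>With the other entries gone, commutation makes \<open>(y3, y6)\<close> a right
      eigenvector for \<open>d\<close> or zero.\<close>
    have "y3 = 0 \<and> y6 = 0" using ker_right[of y3 y6] eqs y124 y5 y9 by auto
    then show "X = 0\<^sub>m 3 3" using X_eq y124 y5 y78 y9 by (simp add: mat3_zero)
  qed simp
qed

subsection \<open>Sign patterns\<close>

text \<open>The criterion of \<open>nSMP_block_iff\<close> as a predicate on numbers, which
  separates the later sign arguments from matrices.\<close>

definition block_nSMP :: "real \<Rightarrow> real \<Rightarrow> real \<Rightarrow> real \<Rightarrow> real \<Rightarrow> bool" where
  "block_nSMP a b e f d \<longleftrightarrow> (a - d) * (f - d) \<noteq> b * e \<and> (b * e \<noteq> 0 \<or> a \<noteq> f)"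

lemma sign_set_nonempty: "\<exists>x. x \<in> sign_set s"
  by (cases s) (auto intro: exI[of _ 1] exI[of _ "-1"])

lemma Q_class_block_iff:
  "M \<in> Q_class (mat3 sa sb sc se sf sg Zero Zero sd) \<longleftrightarrow>
     (\<exists>a\<in>sign_set sa. \<exists>b\<in>sign_set sb. \<exists>c\<in>sign_set sc. \<exists>e\<in>sign_set se. \<exists>f\<in>sign_set sf.
      \<exists>g\<in>sign_set sg. \<exists>d\<in>sign_set sd. M = mat3 a b c e f g 0 0 d)" (is "?L \<longleftrightarrow> ?R")
proof
  assume ?L
  then have "M \<in> carrier_mat 3 3"
    and *: "\<forall>i<3. \<forall>j<3. M $$ (i, j) \<in> sign_set (mat3 sa sb sc se sf sg Zero Zero sd $$ (i, j))"
    by (auto simp: Q_class_iff[OF mat3_carrier])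
  then obtain a b c e f g h i d where M: "M = mat3 a b c e f g h i d"
    by (rule_tac mat3_exhaust) blast
  show ?R using * unfolding M all_less_3 mat3_index mat3_eq_iff by auto
next
  assume ?R
  then show ?L
    by (auto simp: Q_class_iff[OF mat3_carrier] all_less_3 mat3_index simp del: One_nat_def)
qed

lemma allows_block_iff:
  "allows (mat3 sa sb sc se sf sg Zero Zero sd) (nSMP 3) \<longleftrightarrow>
     (\<exists>a\<in>sign_set sa. \<exists>b\<in>sign_set sb. \<exists>e\<in>sign_set se. \<exists>f\<in>sign_set sf. \<exists>d\<in>sign_set sd.
      block_nSMP a b e f d)"
proof -
  have "(\<exists>M \<in> Q_class (mat3 sa sb sc se sf sg Zero Zero sd). P M) \<longleftrightarrow>
     (\<exists>a\<in>sign_set sa. \<exists>b\<in>sign_set sb. \<exists>c\<in>sign_set sc. \<exists>e\<in>sign_set se. \<exists>f\<in>sign_set sf.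
      \<exists>g\<in>sign_set sg. \<exists>d\<in>sign_set sd. P (mat3 a b c e f g 0 0 d))" for P
    unfolding Bex_def Q_class_block_iff by blast
  then show ?thesis
    by (simp only: allows_def nSMP_block_iff block_nSMP_def bex_triv sign_set_nonempty simp_thms)
qed

lemma requires_block_iff:
  "requires (mat3 sa sb sc se sf sg Zero Zero sd) (nSMP 3) \<longleftrightarrow>
     (\<forall>a\<in>sign_set sa. \<forall>b\<in>sign_set sb. \<forall>e\<in>sign_set se. \<forall>f\<in>sign_set sf. \<forall>d\<in>sign_set sd.
      block_nSMP a b e f d)"
proof -
  have "(\<forall>M \<in> Q_class (mat3 sa sb sc se sf sg Zero Zero sd). P M) \<longleftrightarrow>
     (\<forall>a\<in>sign_set sa. \<forall>b\<in>sign_set sb. \<forall>c\<in>sign_set sc. \<forall>e\<in>sign_set se. \<forall>f\<in>sign_set sf.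
      \<forall>g\<in>sign_set sg. \<forall>d\<in>sign_set sd. P (mat3 a b c e f g 0 0 d))" for P
    unfolding Ball_def Bex_def Q_class_block_iff by blast
  then show ?thesis
    by (simp only: requires_def nSMP_block_iff block_nSMP_def ball_triv sign_set_nonempty simp_thms)
qed

text \<open>Every sign pattern has a realization, so the universal statement is never
  vacuous.\<close>

lemma requires_imp_allows:
  assumes "requires A prop"
  shows "allows A prop"
proof -
  have "\<exists>r. \<forall>s. r s \<in> sign_set s" using sign_set_nonempty by metis
  then obtain r where "\<And>s. r s \<in> sign_set s" by blast
  then have "map_mat r A \<in> Q_class A" by (auto simp: Q_class_def pattern_class_def)
  with assms show ?thesis by (auto simp: allows_def requires_def)
qed

section \<open>Fixed signings, entry by entry\<close>

definition admissible :: "gsign \<Rightarrow> sign \<Rightarrow> bool" where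
  "admissible g s \<longleftrightarrow> sign_set s \<subseteq> gsign_set g"

definition representative :: "sign \<Rightarrow> real" where
  "representative s = (case s of Pos \<Rightarrow> 1 | Neg \<Rightarrow> -1 | Zero \<Rightarrow> 0)"

lemma representative_in_sign_set: "representative s \<in> sign_set s"
  by (cases s) (auto simp: representative_def)

text \<open>Every generalized symbol stands for a union of sign classes, so one number of each sign
  decides the inclusion.\<close>

lemma admissible_iff_representative: "admissible g s \<longleftrightarrow> representative s \<in> gsign_set g"
proof
  show "admissible g s \<Longrightarrow> representative s \<in> gsign_set g"
    using representative_in_sign_set[of s] by (auto simp: admissible_def)
  show "representative s \<in> gsign_set g \<Longrightarrow> admissible g s"
    by (cases s; cases g) (auto simp: admissible_def representative_def)
qed

lemma admissible_simps [simp]: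
  "admissible GPos s \<longleftrightarrow> s = Pos" "admissible GNeg s \<longleftrightarrow> s = Neg" "admissible GZero s \<longleftrightarrow> s = Zero"
  "admissible Nonzero s \<longleftrightarrow> s \<noteq> Zero" "admissible Nonneg s \<longleftrightarrow> s \<noteq> Neg"
  "admissible Nonpos s \<longleftrightarrow> s \<noteq> Pos" "admissible Any s"
  by (cases s; simp add: admissible_iff_representative representative_def)+

lemma fixed_signing_mat3_iff:
  "fixed_signing (mat3 a b c d e f g h i) (mat3 a' b' c' d' e' f' g' h' i') \<longleftrightarrow>
   admissible a' a \<and> admissible b' b \<and> admissible c' c \<and> admissible d' d \<and> admissible e' e \<and>
   admissible f' f \<and> admissible g' g \<and> admissible h' h \<and> admissible i' i"
  by (auto simp: fixed_signing_iff_entries all_less_3 mat3_index admissible_def simp del: One_nat_def)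

text \<open>All twelve patterns of the classification have this shape, so five symbols determine
  each of them.\<close>

lemma block_signing_obtain:
  assumes "equivalent_to_signing_of 3 A (mat3 ga gb Any ge gf Any GZero GZero gd)"
  obtains sa sb sc se sf sg sd where
    "equivalent_patterns 3 A (mat3 sa sb sc se sf sg Zero Zero sd)"
    "admissible ga sa" "admissible gb sb" "admissible ge se" "admissible gf sf" "admissible gd sd"
proof -
  obtain A' where "A' \<in> carrier_mat 3 3" "equivalent_patterns 3 A A'"
    "fixed_signing A' (mat3 ga gb Any ge gf Any GZero GZero gd)"
    using assms by (auto simp: equivalent_to_signing_of_def)
  then show ?thesis
    using that by (elim mat3_exhaust) (auto simp: fixed_signing_mat3_iff)
qed

text \<open>The numbers in \<open>good\<close> range over the generalized symbols, so one check
  covers all fixed signings.\<close>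

lemma requires_of_signing:
  assumes A: "A \<in> carrier_mat 3 3"
    and eq: "equivalent_to_signing_of 3 A (mat3 ga gb Any ge gf Any GZero GZero gd)"
    and good: "\<And>a b e f d. a \<in> gsign_set ga \<Longrightarrow> b \<in> gsign_set gb \<Longrightarrow> e \<in> gsign_set ge \<Longrightarrow>
      f \<in> gsign_set gf \<Longrightarrow> d \<in> gsign_set gd \<Longrightarrow> block_nSMP a b e f d"
  shows "requires A (nSMP 3)"
proof (rule block_signing_obtain[OF eq])
  fix sa sb sc se sf sg sd
  assume A': "equivalent_patterns 3 A (mat3 sa sb sc se sf sg Zero Zero sd)"
    and adm: "admissible ga sa" "admissible gb sb" "admissible ge se" "admissible gf sf" "admissible gd sd"
  have "requires (mat3 sa sb sc se sf sg Zero Zero sd) (nSMP 3)"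
    unfolding requires_block_iff using adm good unfolding admissible_def by blast
  then show ?thesis using equivalent_patterns_allows_requires[OF A' A] by blast
qed

text \<open>Here the numbers may depend on the signing: each signing gets one realization meeting
  the criterion and, primed, one violating it.\<close>

lemma allows_not_requires_of_signing:
  assumes A: "A \<in> carrier_mat 3 3"
    and eq: "equivalent_to_signing_of 3 A (mat3 ga gb Any ge gf Any GZero GZero gd)"
    and witnesses: "\<And>sa sb se sf sd. admissible ga sa \<Longrightarrow> admissible gb sb \<Longrightarrow> admissible ge se \<Longrightarrow>
      admissible gf sf \<Longrightarrow> admissible gd sd \<Longrightarrow>
      \<exists>a b e f d a' b' e' f' d'. {a, a'} \<subseteq> sign_set sa \<and> {b, b'} \<subseteq> sign_set sb \<and>
        {e, e'} \<subseteq> sign_set se \<and> {f, f'} \<subseteq> sign_set sf \<and> {d, d'} \<subseteq> sign_set sd \<and>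
        block_nSMP a b e f d \<and> \<not> block_nSMP a' b' e' f' d'"
  shows "allows A (nSMP 3) \<and> \<not> requires A (nSMP 3)"
proof (rule block_signing_obtain[OF eq])
  fix sa sb sc se sf sg sd
  assume A': "equivalent_patterns 3 A (mat3 sa sb sc se sf sg Zero Zero sd)"
    and adm: "admissible ga sa" "admissible gb sb" "admissible ge se" "admissible gf sf" "admissible gd sd"
  from witnesses[OF adm] obtain a b e f d a' b' e' f' d' where
    good: "a \<in> sign_set sa" "b \<in> sign_set sb" "e \<in> sign_set se" "f \<in> sign_set sf" "d \<in> sign_set sd"
      "block_nSMP a b e f d" and
    bad: "a' \<in> sign_set sa" "b' \<in> sign_set sb" "e' \<in> sign_set se" "f' \<in> sign_set sf" "d' \<in> sign_set sd"
      "\<not> block_nSMP a' b' e' f' d'"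
    unfolding insert_subset by (elim exE conjE) (rule that)
  have "allows (mat3 sa sb sc se sf sg Zero Zero sd) (nSMP 3)"
    unfolding allows_block_iff using good by blast
  moreover have "\<not> requires (mat3 sa sb sc se sf sg Zero Zero sd) (nSMP 3)"
    unfolding requires_block_iff using bad by blast
  ultimately show ?thesis using equivalent_patterns_allows_requires[OF A' A] by blast
qed

section \<open>Soundness of the two lists\<close>

definition requiring_patterns :: "gsign mat set" where
  "requiring_patterns =
    {mat3 Any Nonzero Any Nonzero GZero Any GZero GZero GZero,
     mat3 GPos Nonneg Any GPos GNeg Any GZero GZero GZero,
     mat3 GPos GPos Any GNeg GPos Any GZero GZero GZero,
     mat3 Nonpos GPos Any GNeg Nonpos Any GZero GZero GPos,
     mat3 GNeg Any Any GZero GZero Any GZero GZero GPos,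
     mat3 GZero Any Any GZero GNeg Any GZero GZero GPos}"

definition allowing_patterns :: "gsign mat set" where
  "allowing_patterns =
    {mat3 GPos GPos Any GPos GPos Any GZero GZero GZero,
     mat3 GPos GPos Any GNeg GNeg Any GZero GZero GZero,
     mat3 GPos GPos Any GNeg Any Any GZero GZero GPos,
     mat3 Any GPos Any GPos Any Any GZero GZero GPos,
     mat3 GPos Any Any GZero Any Any GZero GZero GPos,
     mat3 Nonpos Any Any GZero GPos Any GZero GZero GPos}"

text \<open>In each pattern the signs alone keep \<open>(a - d) * (f - d)\<close> different from
  \<open>b * e\<close>, and keep \<open>b * e = 0\<close> and \<open>a = f\<close> from holding
  together.\<close>

lemma requires_of_requiring_pattern:
  assumes A: "A \<in> carrier_mat 3 3" and B: "B \<in> requiring_patterns"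
    and eq: "equivalent_to_signing_of 3 A B"
  shows "requires A (nSMP 3)"
proof -
  have mp: "x * y > 0" if "x < 0" "y < 0" for x y :: real using that by (rule mult_neg_neg)
  have mn: "x * y < 0" if "x > 0" "y < 0" for x y :: real using that by (rule mult_pos_neg)
  have neq: "x \<noteq> y" if "x < 0" "y \<ge> 0" for x y :: real using that by simp
  have req: "requires A (nSMP 3)" if "B = mat3 ga gb Any ge gf Any GZero GZero gd"
    "\<And>a b e f d. a \<in> gsign_set ga \<Longrightarrow> b \<in> gsign_set gb \<Longrightarrow> e \<in> gsign_set ge \<Longrightarrow>
      f \<in> gsign_set gf \<Longrightarrow> d \<in> gsign_set gd \<Longrightarrow> block_nSMP a b e f d" for ga gb ge gf gd
    using requires_of_signing[OF A _ that(2)] eq that(1) by blast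
  from B consider
      "B = mat3 Any Nonzero Any Nonzero GZero Any GZero GZero GZero"
    | "B = mat3 GPos Nonneg Any GPos GNeg Any GZero GZero GZero"
    | "B = mat3 GPos GPos Any GNeg GPos Any GZero GZero GZero"
    | "B = mat3 Nonpos GPos Any GNeg Nonpos Any GZero GZero GPos"
    | "B = mat3 GNeg Any Any GZero GZero Any GZero GZero GPos"
    | "B = mat3 GZero Any Any GZero GNeg Any GZero GZero GPos"
    unfolding requiring_patterns_def by blast
  then show ?thesis
  proof cases
    case 1
    then show ?thesis by (rule req) (auto simp: block_nSMP_def)
  next
    case 2
    show ?thesis
    proof (rule req[OF 2])
      fix a b e f d :: real
      assume "a \<in> gsign_set GPos" "b \<in> gsign_set Nonneg" "e \<in> gsign_set GPos" "f \<in> gsign_set GNeg"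
        "d \<in> gsign_set GZero"
      then show "block_nSMP a b e f d"
        using neq[OF mn[of a f], of "b * e"] by (simp add: block_nSMP_def)
    qed
  next
    case 3
    show ?thesis
    proof (rule req[OF 3])
      fix a b e f d :: real
      assume "a \<in> gsign_set GPos" "b \<in> gsign_set GPos" "e \<in> gsign_set GNeg" "f \<in> gsign_set GPos"
        "d \<in> gsign_set GZero"
      then show "block_nSMP a b e f d"
        using neq[OF mn[of b e], of "a * f"] by (simp add: block_nSMP_def)
    qed
  next
    case 4
    show ?thesis
    proof (rule req[OF 4])
      fix a b e f d :: real
      assume "a \<in> gsign_set Nonpos" "b \<in> gsign_set GPos" "e \<in> gsign_set GNeg" "f \<in> gsign_set Nonpos"
        "d \<in> gsign_set GPos"
      then show "block_nSMP a b e f d"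
        using mn[of b e] mp[of "a - d" "f - d"] by (auto simp: block_nSMP_def)
    qed
  next
    case 5
    then show ?thesis by (rule req) (auto simp: block_nSMP_def)
  next
    case 6
    then show ?thesis by (rule req) (auto simp: block_nSMP_def)
  qed
qed

lemma representative_bounds: "representative s \<le> 1" "representative s \<ge> -1"
  by (cases s; simp add: representative_def)+

lemma representative_nonpos: "s \<noteq> Pos \<Longrightarrow> representative s \<le> 0"
  by (cases s) (simp_all add: representative_def)

text \<open>Entries of undetermined sign get their representative, which lies between
  \<open>-1\<close> and \<open>1\<close>. The others are chosen so that changing a single one
  switches between equality and inequality in the determinant condition.\<close>

lemma allows_not_requires_of_allowing_pattern:
  assumes A: "A \<in> carrier_mat 3 3" and B: "B \<in> allowing_patterns"
    and eq: "equivalent_to_signing_of 3 A B"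
  shows "allows A (nSMP 3) \<and> \<not> requires A (nSMP 3)"
proof -
  have alw: "allows A (nSMP 3) \<and> \<not> requires A (nSMP 3)"
    if "B = mat3 ga gb Any ge gf Any GZero GZero gd"
    "\<And>sa sb se sf sd. admissible ga sa \<Longrightarrow> admissible gb sb \<Longrightarrow> admissible ge se \<Longrightarrow>
      admissible gf sf \<Longrightarrow> admissible gd sd \<Longrightarrow>
      \<exists>a b e f d a' b' e' f' d'. {a, a'} \<subseteq> sign_set sa \<and> {b, b'} \<subseteq> sign_set sb \<and>
        {e, e'} \<subseteq> sign_set se \<and> {f, f'} \<subseteq> sign_set sf \<and> {d, d'} \<subseteq> sign_set sd \<and>
        block_nSMP a b e f d \<and> \<not> block_nSMP a' b' e' f' d'" for ga gb ge gf gd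
    using allows_not_requires_of_signing[OF A _ that(2)] eq that(1) by blast
  let ?r = representative
  note r = representative_in_sign_set representative_bounds
  from B consider
      "B = mat3 GPos GPos Any GPos GPos Any GZero GZero GZero"
    | "B = mat3 GPos GPos Any GNeg GNeg Any GZero GZero GZero"
    | "B = mat3 GPos GPos Any GNeg Any Any GZero GZero GPos"
    | "B = mat3 Any GPos Any GPos Any Any GZero GZero GPos"
    | "B = mat3 GPos Any Any GZero Any Any GZero GZero GPos"
    | "B = mat3 Nonpos Any Any GZero GPos Any GZero GZero GPos"
    unfolding allowing_patterns_def by blast
  then show ?thesis
  proof cases
    case 1
    \<comment> \<open>The first five values satisfy the criterion, the last five violate it. Here
      \<open>a * f = 1\<close>, and \<open>b\<close> changes from \<open>2\<close> to
      \<open>1\<close>.\<close>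
    show ?thesis
      by (rule alw[OF 1], rule exI[of _ 1], rule exI[of _ 2], rule exI[of _ 1], rule exI[of _ 1],
          rule exI[of _ 0], rule exI[of _ 1], rule exI[of _ 1], rule exI[of _ 1], rule exI[of _ 1],
          rule exI[of _ 0]) (simp add: block_nSMP_def)
  next
    case 2
    show ?thesis
      by (rule alw[OF 2], rule exI[of _ 1], rule exI[of _ 2], rule exI[of _ "-1"], rule exI[of _ "-1"],
          rule exI[of _ 0], rule exI[of _ 1], rule exI[of _ 1], rule exI[of _ "-1"], rule exI[of _ "-1"],
          rule exI[of _ 0]) (simp add: block_nSMP_def)
  next
    case 3
    show ?thesis
    proof (rule alw[OF 3])
      fix sa sb se sf sd
      assume "admissible GPos sa" "admissible GPos sb" "admissible GNeg se" "admissible GPos sd"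
      \<comment> \<open>With \<open>a - d = 1\<close> and \<open>b = 1\<close>, equality means
        \<open>e = f - 2\<close>; this is negative, as is \<open>f - 3\<close>, because the
        representative is at most \<open>1\<close>.\<close>
      then show "\<exists>a b e f d a' b' e' f' d'. {a, a'} \<subseteq> sign_set sa \<and> {b, b'} \<subseteq> sign_set sb \<and>
        {e, e'} \<subseteq> sign_set se \<and> {f, f'} \<subseteq> sign_set sf \<and> {d, d'} \<subseteq> sign_set sd \<and>
        block_nSMP a b e f d \<and> \<not> block_nSMP a' b' e' f' d'"
        using r[of sf]
        by - (rule exI[of _ 3], rule exI[of _ 1], rule exI[of _ "?r sf - 3"], rule exI[of _ "?r sf"],
            rule exI[of _ 2], rule exI[of _ 3], rule exI[of _ 1], rule exI[of _ "?r sf - 2"],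
            rule exI[of _ "?r sf"], rule exI[of _ 2], auto simp: block_nSMP_def)
    qed
  next
    case 4
    show ?thesis
    proof (rule alw[OF 4])
      fix sa sb se sf sd
      assume "admissible GPos sb" "admissible GPos se" "admissible GPos sd"
      \<comment> \<open>Taking \<open>d = 2\<close> above both representatives makes the product
        positive, hence a legal value for \<open>b\<close> when \<open>e = 1\<close>; adding
        \<open>1\<close> breaks the equality.\<close>
      moreover have "(?r sa - 2) * (?r sf - 2) > 0"
        using r[of sa] r[of sf] by (intro mult_neg_neg) auto
      ultimately show "\<exists>a b e f d a' b' e' f' d'. {a, a'} \<subseteq> sign_set sa \<and> {b, b'} \<subseteq> sign_set sb \<and>
        {e, e'} \<subseteq> sign_set se \<and> {f, f'} \<subseteq> sign_set sf \<and> {d, d'} \<subseteq> sign_set sd \<and>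
        block_nSMP a b e f d \<and> \<not> block_nSMP a' b' e' f' d'"
        using r[of sa] r[of sf]
        by - (rule exI[of _ "?r sa"], rule exI[of _ "(?r sa - 2) * (?r sf - 2) + 1"], rule exI[of _ 1],
            rule exI[of _ "?r sf"], rule exI[of _ 2],
            rule exI[of _ "?r sa"], rule exI[of _ "(?r sa - 2) * (?r sf - 2)"], rule exI[of _ 1],
            rule exI[of _ "?r sf"], rule exI[of _ 2], simp add: block_nSMP_def)
    qed
  next
    case 5
    show ?thesis
    proof (rule alw[OF 5])
      fix sa sb se sf sd
      assume "admissible GPos sa" "admissible GZero se" "admissible GPos sd"
      \<comment> \<open>As \<open>e = 0\<close>, the determinant condition says that
        \<open>d\<close> avoids \<open>a\<close> and \<open>f\<close>: \<open>d = 3\<close> does so,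
        \<open>d = 2\<close> equals \<open>a\<close>.\<close>
      then show "\<exists>a b e f d a' b' e' f' d'. {a, a'} \<subseteq> sign_set sa \<and> {b, b'} \<subseteq> sign_set sb \<and>
        {e, e'} \<subseteq> sign_set se \<and> {f, f'} \<subseteq> sign_set sf \<and> {d, d'} \<subseteq> sign_set sd \<and>
        block_nSMP a b e f d \<and> \<not> block_nSMP a' b' e' f' d'"
        using r[of sb] r[of sf]
        by - (rule exI[of _ 2], rule exI[of _ "?r sb"], rule exI[of _ 0],
            rule exI[of _ "?r sf"], rule exI[of _ 3],
            rule exI[of _ 2], rule exI[of _ "?r sb"], rule exI[of _ 0],
            rule exI[of _ "?r sf"], rule exI[of _ 2], auto simp: block_nSMP_def)
    qed
  next
    case 6
    show ?thesis
    proof (rule alw[OF 6])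
      fix sa sb se sf sd
      assume "admissible Nonpos sa" "admissible GZero se" "admissible GPos sf" "admissible GPos sd"
      \<comment> \<open>Again \<open>e = 0\<close>; now \<open>d = 2\<close> collides with
        \<open>f\<close>, whereas \<open>d = 3\<close> avoids both diagonal entries.\<close>
      then show "\<exists>a b e f d a' b' e' f' d'. {a, a'} \<subseteq> sign_set sa \<and> {b, b'} \<subseteq> sign_set sb \<and>
        {e, e'} \<subseteq> sign_set se \<and> {f, f'} \<subseteq> sign_set sf \<and> {d, d'} \<subseteq> sign_set sd \<and>
        block_nSMP a b e f d \<and> \<not> block_nSMP a' b' e' f' d'"
        using r[of sb] r[of sa] representative_nonpos[of sa]
        by - (rule exI[of _ "?r sa"], rule exI[of _ "?r sb"], rule exI[of _ 0],
            rule exI[of _ 2], rule exI[of _ 3],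
            rule exI[of _ "?r sa"], rule exI[of _ "?r sb"], rule exI[of _ 0],
            rule exI[of _ 2], rule exI[of _ 2], auto simp: block_nSMP_def)
    qed
  qed
qed

section \<open>Exhaustiveness of the two lists\<close>

definition classified :: "sign mat \<Rightarrow> bool" where
  "classified A \<longleftrightarrow>
     (\<exists>B \<in> requiring_patterns \<union> allowing_patterns. equivalent_to_signing_of 3 A B) \<or>
     \<not> allows A (nSMP 3)"

text \<open>Both alternatives are invariant under steps, so a pattern may be replaced by any pattern
  one step away.\<close>

lemma classified_step:
  assumes "pattern_step 3 A B" "A \<in> carrier_mat 3 3" "classified B"
  shows "classified A"
  using assms(3) equivalent_to_signing_of_step[OF assms(1)] pattern_step_allows_requires[OF assms(1,2)]
  unfolding classified_def by blast

text \<open>Equivalence steps move \<open>c\<close> and \<open>g\<close> and change their signs;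
  quantifying over both leaves only five signs to track in each reduction.\<close>

definition block_classified :: "sign \<Rightarrow> sign \<Rightarrow> sign \<Rightarrow> sign \<Rightarrow> sign \<Rightarrow> bool" where
  "block_classified a b e f d \<longleftrightarrow> (\<forall>c g. classified (mat3 a b c e f g Zero Zero d))"

lemma block_classified_of_pattern:
  assumes "mat3 ga gb Any ge gf Any GZero GZero gd \<in> requiring_patterns \<union> allowing_patterns"
    and "admissible ga a" "admissible gb b" "admissible ge e" "admissible gf f" "admissible gd d"
  shows "block_classified a b e f d"
proof -
  have "equivalent_to_signing_of 3 (mat3 a b c e f g Zero Zero d)
      (mat3 ga gb Any ge gf Any GZero GZero gd)" for c g
    unfolding equivalent_to_signing_of_def equivalent_patterns_def
    by (rule bexI[of _ "mat3 a b c e f g Zero Zero d"])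
      (use assms in \<open>auto simp: fixed_signing_mat3_iff\<close>)
  then show ?thesis
    using assms(1) unfolding block_classified_def classified_def by blast
qed

lemma block_classified_negate:
  assumes "block_classified (sign_neg a) (sign_neg b) (sign_neg e) (sign_neg f) (sign_neg d)"
  shows "block_classified a b e f d"
  unfolding block_classified_def
proof (intro allI)
  fix c g
  have "pattern_step 3 (mat3 a b c e f g Zero Zero d)
     (mat3 (sign_neg a) (sign_neg b) (sign_neg c) (sign_neg e) (sign_neg f) (sign_neg g) Zero Zero (sign_neg d))"
    using pattern_step.negation[of 3 "mat3 a b c e f g Zero Zero d"] by (simp add: mat3_map)
  then show "classified (mat3 a b c e f g Zero Zero d)"
    by (rule classified_step) (use assms in \<open>simp_all add: block_classified_def\<close>)
qed

text \<open>Conjugation by the diagonal matrix with entries \<open>-1, 1, 1\<close> changes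
  \<open>b\<close> and \<open>e\<close> but no diagonal entry.\<close>

lemma block_classified_flip:
  assumes "block_classified a (sign_neg b) (sign_neg e) f d"
  shows "block_classified a b e f d"
  unfolding block_classified_def
proof (intro allI)
  fix c g
  let ?s = "\<lambda>i::nat. if i = 0 then Neg else Pos"
  have "signature_mat ?s (mat3 a b c e f g Zero Zero d) =
      mat3 a (sign_neg b) (sign_neg c) (sign_neg e) f g Zero Zero d"
    by (rule mat3_eqI)
      (simp_all add: signature_mat_def mat3_index sign_mult_Pos_right sign_mult_Neg_right
        carrier_matI flip: One_nat_def)
  then have "pattern_step 3 (mat3 a b c e f g Zero Zero d)
     (mat3 a (sign_neg b) (sign_neg c) (sign_neg e) f g Zero Zero d)"
    using pattern_step.signature[of 3 ?s "mat3 a b c e f g Zero Zero d"] by simp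
  then show "classified (mat3 a b c e f g Zero Zero d)"
    by (rule classified_step) (use assms in \<open>simp_all add: block_classified_def\<close>)
qed

lemma permute_mat3_01:
  "permute_mat (Transposition.transpose 0 1) (mat3 a b c d e f g h i) = mat3 e d f b a c h g i"
  by (rule mat3_eqI)
    (simp_all add: permute_mat_def Transposition.transpose_def mat3_index carrier_matI flip: One_nat_def)

lemma permute_mat3_02:
  "permute_mat (Transposition.transpose 0 2) (mat3 a b c d e f g h i) = mat3 i h g f e d c b a"
  by (rule mat3_eqI)
    (simp_all add: permute_mat_def Transposition.transpose_def mat3_index carrier_matI flip: One_nat_def)

lemma block_classified_swap:
  assumes "block_classified f e b a d"
  shows "block_classified a b e f d"
  unfolding block_classified_def
proof (intro allI)
  fix c g
  have "Transposition.transpose 0 1 permutes {..<3::nat}" by (rule permutes_swap_id) auto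
  from pattern_step.permutation[OF this, of "mat3 a b c e f g Zero Zero d"]
  show "classified (mat3 a b c e f g Zero Zero d)"
    by (rule classified_step) (use assms in \<open>simp_all add: block_classified_def permute_mat3_01 del: One_nat_def\<close>)
qed

text \<open>Transposition followed by exchanging the outer indices is reflection in the
  antidiagonal. It preserves upper block triangularity and reverses the diagonal.\<close>

lemma classified_transpose_reverse:
  assumes "classified (mat3 i f c h e b g d a)"
  shows "classified (mat3 a b c d e f g h i)"
proof (rule classified_step)
  show "pattern_step 3 (mat3 a b c d e f g h i) (mat3 a d g b e h c f i)"
    using pattern_step.transposition[of 3 "mat3 a b c d e f g h i"] by (simp only: mat3_transpose)
  have "Transposition.transpose 0 2 permutes {..<3::nat}" by (rule permutes_swap_id) auto
  from pattern_step.permutation[OF this, of "mat3 a d g b e h c f i"]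
  show "classified (mat3 a d g b e h c f i)"
    by (rule classified_step) (use assms in \<open>simp_all add: permute_mat3_02\<close>)
qed simp

text \<open>Reflection in the antidiagonal exchanges \<open>b\<close> and \<open>g\<close>, so
  \<open>b\<close> has to be arbitrary as well for reversal to apply.\<close>

definition triangular_classified :: "sign \<Rightarrow> sign \<Rightarrow> sign \<Rightarrow> bool" where
  "triangular_classified a f d \<longleftrightarrow> (\<forall>b. block_classified a b Zero f d)"

lemma triangular_classified_negate:
  "triangular_classified (sign_neg a) (sign_neg f) (sign_neg d) \<Longrightarrow> triangular_classified a f d"
  unfolding triangular_classified_def by (auto intro: block_classified_negate)

lemma triangular_classified_reverse:
  "triangular_classified d f a \<Longrightarrow> triangular_classified a f d"
  unfolding triangular_classified_def block_classified_def
  by (blast intro: classified_transpose_reverse)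

text \<open>Two zero diagonal entries make \<open>0\<close> a repeated eigenvalue: either it is
  shared by the two diagonal blocks, or it is double in the triangular leading block.\<close>

lemma triangular_classified_of_two_zeros:
  assumes "a = Zero \<and> f = Zero \<or> a = Zero \<and> d = Zero \<or> f = Zero \<and> d = Zero"
  shows "triangular_classified a f d"
proof -
  have "\<not> allows (mat3 a b c Zero f g Zero Zero d) (nSMP 3)" for b c g
    unfolding allows_block_iff using assms by (auto simp: block_nSMP_def)
  then show ?thesis by (simp add: triangular_classified_def block_classified_def classified_def)
qed

lemma triangular_classified: "triangular_classified a f d"
proof -
  have 1: "triangular_classified Neg Zero Pos"
    unfolding triangular_classified_def
    by (intro allI block_classified_of_pattern[of GNeg Any GZero GZero GPos])
      (simp_all add: requiring_patterns_def)
  have 2: "triangular_classified Zero Neg Pos"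
    unfolding triangular_classified_def
    by (intro allI block_classified_of_pattern[of GZero Any GZero GNeg GPos])
      (simp_all add: requiring_patterns_def)
  have 3: "triangular_classified Pos x Pos" for x
    unfolding triangular_classified_def
    by (intro allI block_classified_of_pattern[of GPos Any GZero Any GPos])
      (simp_all add: allowing_patterns_def)
  have 4: "triangular_classified x Pos Pos" if "x \<noteq> Pos" for x
    unfolding triangular_classified_def
    by (intro allI block_classified_of_pattern[of Nonpos Any GZero GPos GPos])
      (use that in \<open>simp_all add: allowing_patterns_def\<close>)
  note zero = triangular_classified_of_two_zeros
  note neg = triangular_classified_negate and rev = triangular_classified_reverse
  \<comment> \<open>Reversal and negation turn this diagonal into
    \<open>Neg, Pos, Pos\<close>.\<close>
  have 5: "triangular_classified Neg Neg Pos" by (rule rev, rule neg) (simp add: 4)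
  have pos: "triangular_classified a f Pos" for a f
    by (cases a; cases f) (simp_all add: 1 2 3 4 5 zero)
  have Neg: "triangular_classified a f Neg" for a f by (rule neg) (simp add: pos)
  \<comment> \<open>Reversal puts \<open>a\<close> in the last corner; unless it is
    \<open>Zero\<close> too, the corner is nonzero and already treated.\<close>
  have "triangular_classified a f Zero" for a f
    by (rule rev, cases a) (simp_all add: pos Neg zero)
  with pos Neg show ?thesis by (cases d) auto
qed

lemma block_classified: "block_classified a b e f d"
proof (cases "b = Zero \<or> e = Zero")
  case True
  then show ?thesis
    using triangular_classified block_classified_swap unfolding triangular_classified_def by blast
next
  case False
  note neg = block_classified_negate and flip = block_classified_flip and swap = block_classified_swap
  note of_pattern = block_classified_of_pattern
  \<comment> \<open>With a zero corner, a zero on the leading diagonal leads to the pattern in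
    \<open>z1\<close>. Otherwise negation, which fixes the corner, and the symmetries of the leading
    block reduce all signs to \<open>z2\<close> through \<open>z5\<close>.\<close>
  have zero: "block_classified a Pos e f Zero" if "e \<noteq> Zero" for a e f
  proof -
    have z1: "block_classified a b e Zero Zero" if "b \<noteq> Zero" "e \<noteq> Zero" for a b e
      by (rule of_pattern[of Any Nonzero Nonzero GZero GZero])
        (use that in \<open>simp_all add: requiring_patterns_def\<close>)
    have z2: "block_classified Pos Pos Pos Neg Zero"
      by (rule of_pattern[of GPos Nonneg GPos GNeg GZero]) (simp_all add: requiring_patterns_def)
    have z3: "block_classified Pos Pos Neg Pos Zero"
      by (rule of_pattern[of GPos GPos GNeg GPos GZero]) (simp_all add: requiring_patterns_def)
    have z4: "block_classified Pos Pos Pos Pos Zero"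
      by (rule of_pattern[of GPos GPos GPos GPos GZero]) (simp_all add: allowing_patterns_def)
    have z5: "block_classified Pos Pos Neg Neg Zero"
      by (rule of_pattern[of GPos GPos GNeg GNeg GZero]) (simp_all add: allowing_patterns_def)
    show ?thesis
    proof (cases "a = Zero \<or> f = Zero")
      case True
      then show ?thesis using z1 swap \<open>e \<noteq> Zero\<close> by blast
    next
      case False
      have z6: "block_classified Neg Pos Neg Neg Zero" by (rule neg, rule swap) (simp add: z3)
      have z7: "block_classified Neg Pos Pos Neg Zero" by (rule neg, rule flip) (simp add: z4)
      have z8: "block_classified Neg Pos Neg Pos Zero" by (rule neg, rule flip) (simp add: z5)
      have z9: "block_classified Neg Pos Pos Pos Zero" by (rule swap) (rule z2)
      show ?thesis
        using False \<open>e \<noteq> Zero\<close> z2 z3 z4 z5 z6 z7 z8 z9 by (cases a; cases f; cases e) auto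
    qed
  qed
  \<comment> \<open>With a positive corner, only the case of opposite off-diagonal signs depends on
    the leading diagonal: it is on the first list exactly when no \<open>Pos\<close> occurs
    there.\<close>
  have pos: "block_classified a Pos e f Pos" if "e \<noteq> Zero" for a e f
  proof -
    have p1: "block_classified a Pos Neg f Pos" if "a \<noteq> Pos" "f \<noteq> Pos" for a f
      by (rule of_pattern[of Nonpos GPos GNeg Nonpos GPos])
        (use that in \<open>simp_all add: requiring_patterns_def\<close>)
    have p2: "block_classified Pos Pos Neg f Pos" for f
      by (rule of_pattern[of GPos GPos GNeg Any GPos]) (simp_all add: allowing_patterns_def)
    have p3: "block_classified a Pos Neg Pos Pos" for a
      by (rule swap, rule flip) (simp add: p2)
    have p4: "block_classified a Pos Pos f Pos" for a f
      by (rule of_pattern[of Any GPos GPos Any GPos]) (simp_all add: allowing_patterns_def)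
    show ?thesis using \<open>e \<noteq> Zero\<close> p1 p2 p3 p4 by (cases e) metis+
  qed
  \<comment> \<open>The flip makes \<open>b\<close> positive without touching the corner; a negative
    corner is removed afterwards by negating the whole pattern.\<close>
  have sign: "block_classified a b e f d" if "b \<noteq> Zero" "e \<noteq> Zero" "d \<noteq> Neg" for a b e f d
  proof (cases b)
    case Neg
    have "block_classified a Pos (sign_neg e) f d"
      using zero pos \<open>e \<noteq> Zero\<close> \<open>d \<noteq> Neg\<close> by (cases d; cases e) auto
    then show ?thesis using flip[of a b e f d] Neg by simp
  qed (use zero pos that in \<open>cases d; auto\<close>)+
  show ?thesis
  proof (cases "d = Neg")
    case True
    show ?thesis
      by (rule neg, rule sign) (use False True in \<open>cases b; cases e; simp\<close>)+
  qed (use sign False in auto)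
qed

text \<open>The zero block lies either in the last row or in the first column; reflection in the
  antidiagonal carries the second situation to the first.\<close>

lemma reducible_classified:
  assumes A: "A \<in> carrier_mat 3 3" and red: "reducible_pattern 3 A"
  shows "classified A"
proof -
  obtain p k where p: "p permutes {..<3}" and k: "0 < k" "k < 3"
    and zero: "\<And>i j. k \<le> i \<Longrightarrow> i < 3 \<Longrightarrow> j < k \<Longrightarrow> permute_mat p A $$ (i, j) = Zero"
    using red by (auto simp: reducible_pattern_def)
  obtain a b c d e f g h i where PA: "permute_mat p A = mat3 a b c d e f g h i"
    using mat3_eta[OF permute_mat_carrier[OF A, of p]] that by blast
  have "classified (mat3 a b c d e f g h i)"
  proof (cases "k = 1")
    case True
    then have "d = Zero" "g = Zero" using zero[of 1 0] zero[of 2 0] by (simp_all add: PA mat3_index del: One_nat_def)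
    then show ?thesis
      using block_classified classified_transpose_reverse unfolding block_classified_def by blast
  next
    case False
    with k have "k = 2" by simp
    then have "g = Zero" "h = Zero" using zero[of 2 0] zero[of 2 1] by (simp_all add: PA mat3_index del: One_nat_def)
    then show ?thesis using block_classified unfolding block_classified_def by blast
  qed
  then show ?thesis using pattern_step.permutation[OF p, of A] PA classified_step[OF _ A] by simp
qed

text \<open>The lists imply incompatible properties and jointly cover every pattern that allows the
  nSMP, so each property can hold only through its own list.\<close>

lemma reducible_nSMP_classification:
  assumes A: "A \<in> carrier_mat 3 3" and red: "reducible_pattern 3 A"
  shows "(requires A (nSMP 3) \<longleftrightarrow> (\<exists>B \<in> requiring_patterns. equivalent_to_signing_of 3 A B)) \<and>
    (allows A (nSMP 3) \<and> \<not> requires A (nSMP 3) \<longleftrightarrow>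
      (\<exists>B \<in> allowing_patterns. equivalent_to_signing_of 3 A B))"
  using reducible_classified[OF A red] requires_of_requiring_pattern[OF A]
    allows_not_requires_of_allowing_pattern[OF A] requires_imp_allows[of A "nSMP 3"]
  unfolding classified_def by blast

theorem theorem6p6:
  fixes A :: "sign mat"
  assumes "A \<in> carrier_mat 3 3"
    and "reducible_pattern 3 A"
  shows "(requires A (nSMP 3) \<longleftrightarrow>
      (\<exists>B \<in>
       {mat_of_rows_list 3 [[Any, Nonzero, Any],
                            [Nonzero, GZero, Any],
                            [GZero, GZero, GZero]],
        mat_of_rows_list 3 [[GPos, Nonneg, Any],
                            [GPos, GNeg, Any],
                            [GZero, GZero, GZero]],
        mat_of_rows_list 3 [[GPos, GPos, Any],
                            [GNeg, GPos, Any],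
                            [GZero, GZero, GZero]],
        mat_of_rows_list 3 [[Nonpos, GPos, Any],
                            [GNeg, Nonpos, Any],
                            [GZero, GZero, GPos]],
        mat_of_rows_list 3 [[GNeg, Any, Any],
                            [GZero, GZero, Any],
                            [GZero, GZero, GPos]],
        mat_of_rows_list 3 [[GZero, Any, Any],
                            [GZero, GNeg, Any],
                            [GZero, GZero, GPos]]}.
        equivalent_to_signing_of 3 A B)) \<and>
    (allows A (nSMP 3) \<and> \<not> requires A (nSMP 3) \<longleftrightarrow>
      (\<exists>B \<in>
       {mat_of_rows_list 3 [[GPos, GPos, Any],
                            [GPos, GPos, Any],
                            [GZero, GZero, GZero]],
        mat_of_rows_list 3 [[GPos, GPos, Any],
                            [GNeg, GNeg, Any],
                            [GZero, GZero, GZero]],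
        mat_of_rows_list 3 [[GPos, GPos, Any],
                            [GNeg, Any, Any],
                            [GZero, GZero, GPos]],
        mat_of_rows_list 3 [[Any, GPos, Any],
                            [GPos, Any, Any],
                            [GZero, GZero, GPos]],
        mat_of_rows_list 3 [[GPos, Any, Any],
                            [GZero, Any, Any],
                            [GZero, GZero, GPos]],
        mat_of_rows_list 3 [[Nonpos, Any, Any],
                            [GZero, GPos, Any],
                            [GZero, GZero, GPos]]}.
        equivalent_to_signing_of 3 A B))"
  using reducible_nSMP_classification[OF assms]
  unfolding requiring_patterns_def allowing_patterns_def .

end
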